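(* For each $\varepsilon>0$ there exist a graph $G$ and a surjective $\varepsilon$-map $f\colon \mathbb{S}^1\rightarrow G$ such that the element of $\pi_1(G)$ represented by the loop $f$ is not a generator in a free basis of the free group $\pi_1(G)$ (that is, no free basis of $\pi_1(G)$ contains this element).
   Context: $\mathbb{S}^1$ is the standard unit circle with its standard metric. A graph is a $1$-dimensional CW complex, regarded as a topological space. Maps are continuous. A map $f\colon \mathbb{S}^1\to G$ is an $\varepsilon$-map if for every point $p\in G$ the pre-image $f^{-1}(p)\subset \mathbb{S}^1$ has diameter less than $\varepsilon$. Since $f$ is surjective, $G$ is connected and $\pi_1(G)$ is a free group. Fix a base point $x\in\mathbb{S}^1$ and an orientation of $\mathbb{S}^1$; the loop $f$ then represents an element of $\pi_1(G)=\pi_1(G,f(x))$. Whether this element belongs to some free basis does not depend on the choice of base point or orientation. *)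

theory Defs
  imports "HOL-Analysis.Analysis" "HOL-Algebra.Generated_Groups"
begin

text \<open>
  A 1-dimensional CW complex, in Whitehead's form. \<open>V\<close> is the set of 0-cells and \<open>E\<close> the set of
  characteristic maps \<open>[0,1] \<rightarrow> X\<close> of the 1-cells (only their values on the unit interval matter;
  different maps in \<open>E\<close> have disjoint open cells, so no 1-cell is listed twice). Closure-finiteness
  is automatic, as the boundary of a 1-cell has at most two points. The last conjunct is the
  weak topology; the condition for the closures \<open>{v}\<close> of the 0-cells holds in any Hausdorff space.
  Loops, multiple edges, isolated vertices and infinitely many cells are allowed. \<open>E \<noteq> {}\<close> says
  that the dimension is exactly 1.
\<close>

definition graph_structure :: "'a topology \<Rightarrow> 'a set \<Rightarrow> (real \<Rightarrow> 'a) set \<Rightarrow> bool" where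
  "graph_structure X V E \<longleftrightarrow>
     V \<subseteq> topspace X \<and> E \<noteq> {} \<and>
     (\<forall>e\<in>E. pathin X e \<and> e 0 \<in> V \<and> e 1 \<in> V \<and>
            embedding_map (top_of_set {0<..<1}) X e \<and>
            disjnt (e ` {0<..<1}) V) \<and>
     pairwise (\<lambda>e e'. disjnt (e ` {0<..<1}) (e' ` {0<..<1})) E \<and>
     topspace X = V \<union> (\<Union>e\<in>E. e ` {0<..<1}) \<and>
     (\<forall>A. A \<subseteq> topspace X \<longrightarrow>
          (closedin X A \<longleftrightarrow> (\<forall>e\<in>E. closedin X (A \<inter> e ` {0..1}))))"

definition is_graph :: "'a topology \<Rightarrow> bool" where
  "is_graph X \<longleftrightarrow> Hausdorff_space X \<and> (\<exists>V E. graph_structure X V E)"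

definition loop_at :: "'a topology \<Rightarrow> 'a \<Rightarrow> (real \<Rightarrow> 'a) \<Rightarrow> bool" where
  "loop_at X x p \<longleftrightarrow> pathin X p \<and> p 0 = x \<and> p 1 = x"

text \<open>Based homotopy class; paths are functions on \<open>real\<close> of which only the values on \<open>[0,1]\<close> matter.\<close>

definition loop_class :: "'a topology \<Rightarrow> 'a \<Rightarrow> (real \<Rightarrow> 'a) \<Rightarrow> (real \<Rightarrow> 'a) set" where
  "loop_class X x p =
     {q. homotopic_with (\<lambda>r. r 0 = x \<and> r 1 = x) (top_of_set {0..1}) X p q}"

text \<open>
  The classes \<open>loop_class X x (p +++ q)\<close> in the union below all coincide. The sort constraint
  only comes from the type of \<open>(+++)\<close>; the topology in use is \<open>X\<close>, not that of the type.
\<close>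

definition fundamental_group ::
  "'a::topological_space topology \<Rightarrow> 'a \<Rightarrow> (real \<Rightarrow> 'a) set monoid" where
  "fundamental_group X x =
     \<lparr> carrier = loop_class X x ` {p. loop_at X x p},
       mult = (\<lambda>a b. \<Union>p\<in>a. \<Union>q\<in>b. loop_class X x (p +++ q)),
       one = loop_class X x (\<lambda>_. x) \<rparr>"

text \<open>
  Words over \<open>B\<close>: the letter \<open>(b, True)\<close> stands for \<open>b\<close> and \<open>(b, False)\<close> for its inverse.
\<close>

definition eval_word :: "('a, 'c) monoid_scheme \<Rightarrow> ('a \<times> bool) list \<Rightarrow> 'a" where
  "eval_word G w =
     foldr (\<lambda>(b, s) g. (if s then b else inv\<^bsub>G\<^esub> b) \<otimes>\<^bsub>G\<^esub> g) w \<one>\<^bsub>G\<^esub>"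

definition reduced_word :: "('a \<times> bool) list \<Rightarrow> bool" where
  "reduced_word w \<longleftrightarrow> successively (\<lambda>(b, s) (c, t). \<not> (b = c \<and> s \<noteq> t)) w"

definition free_basis :: "('a, 'c) monoid_scheme \<Rightarrow> 'a set \<Rightarrow> bool" where
  "free_basis G B \<longleftrightarrow>
     B \<subseteq> carrier G \<and> generate G B = carrier G \<and>
     (\<forall>w. set w \<subseteq> B \<times> UNIV \<and> reduced_word w \<and> w \<noteq> [] \<longrightarrow> eval_word G w \<noteq> \<one>\<^bsub>G\<^esub>)"

text \<open>
  The circle is \<open>sphere 0 1\<close> in the complex plane with the induced metric.
\<close>

definition eps_map :: "real \<Rightarrow> 'a topology \<Rightarrow> (complex \<Rightarrow> 'a) \<Rightarrow> bool" where
  "eps_map \<epsilon> G f \<longleftrightarrow>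
     continuous_map (top_of_set (sphere 0 1)) G f \<and>
     (\<forall>p\<in>topspace G. diameter {z \<in> sphere 0 1. f z = p} < \<epsilon>)"

text \<open>
  The loop given by \<open>f\<close>, based at \<open>f x\<close>, where \<open>\<sigma> = 1\<close> is the counterclockwise and \<open>\<sigma> = -1\<close>
  the clockwise orientation of the circle.
\<close>

definition circle_loop :: "complex \<Rightarrow> real \<Rightarrow> (complex \<Rightarrow> 'a) \<Rightarrow> real \<Rightarrow> 'a" where
  "circle_loop x \<sigma> f t = f (x * cis (\<sigma> * (2 * pi * t)))"

end

theory Submission
  imports Defs "HOL-Complex_Analysis.Winding_Numbers"
begin

text \<open>
  Let \<open>G\<close> be a circle of length \<open>N\<close> (the longitude) with a loop (a meridian) attached at each of its
  vertices \<open>v\<^sub>0, \<dots>, v\<^bsub>N-1\<^esub>\<close>. It sits on the torus and is the image of the grid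
  \<open>{(s, u). s \<in> \<int> \<or> u \<in> \<int>}\<close> of the plane. Over the \<open>k\<close>-th of \<open>N\<close> equal arcs, the map \<open>f\<close> runs once around
  the boundary of the square \<open>[k, k+1] \<times> [0, 1]\<close> and then advances along the edge from \<open>(k, 0)\<close> to
  \<open>(k+1, 0)\<close>. So its position along the longitude is always within one edge of uniform motion, and
  points of the circle with the same image have distance at most \<open>4\<pi>/N\<close>.

  Let \<open>Y\<^sub>k\<close> be the class of the loop that goes along the longitude to \<open>(k, 0)\<close>, once around the meridian,
  and back; let \<open>\<tau>\<close> be the longitude. Then
  \<open>[f] = (Y\<^sub>1 Y\<^sub>0\<^sup>-\<^sup>1) (Y\<^sub>2 Y\<^sub>1\<^sup>-\<^sup>1) \<dots> (Y\<^sub>N Y\<^bsub>N-1\<^esub>\<^sup>-\<^sup>1) \<tau>\<close>, and \<open>Y\<^sub>N = \<tau> Y\<^sub>0 \<tau>\<^sup>-\<^sup>1\<close> because \<open>N\<close> steps close up to a full turn.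
  The homology of \<open>G\<close> cannot show that \<open>[f]\<close> lies in no free basis, as \<open>[f]\<close> is homologous to \<open>\<tau>\<close>, which
  does lie in one. Metabelian quotients can: let
  \<open>\<rho>\<close> send a loop to \<open>2\<close> to the power of its winding number in the meridian direction, and let \<open>d\<close> be a
  derivation, that is, \<open>d (a b) = d a + \<rho> a \<cdot> d b\<close>. Since \<open>\<rho> Y\<^sub>k = 2\<close> for all \<open>k\<close>, the product telescopes under
  \<open>d\<close> and \<open>d [f] = d Y\<^sub>N - d Y\<^sub>0 + d \<tau>\<close>. Since \<open>\<rho> \<tau> = 1\<close>, the relation \<open>Y\<^sub>N \<tau> = \<tau> Y\<^sub>0\<close> gives
  \<open>d Y\<^sub>N + 2 d \<tau> = d \<tau> + d Y\<^sub>0\<close>. Hence \<open>d [f] = 0\<close> for every \<open>d\<close>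
  (\<open>telescoping_product_not_in_free_basis\<close>). But a derivation may be prescribed freely on a free
  basis (\<open>free_basis_derivation\<close>), so an element of one has \<open>d = 1\<close> for some \<open>d\<close>.

  The decomposition of \<open>[f]\<close> is \<open>tethered_class_lap\<close>, applied \<open>N\<close> times; that \<open>G\<close> is a graph is
  \<open>is_graph_necklace\<close>, and the size of the fibres comes from \<open>necklace_loop_fibre\<close>.
\<close>

section \<open>Homomorphisms out of a group with a free basis\<close>

lemma eval_word_Nil [simp]: "eval_word G [] = \<one>\<^bsub>G\<^esub>"
  by (simp add: eval_word_def)

lemma eval_word_Cons [simp]:
  "eval_word G ((b, s) # w) = (if s then b else inv\<^bsub>G\<^esub> b) \<otimes>\<^bsub>G\<^esub> eval_word G w"
  by (simp add: eval_word_def)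

context group
begin

lemma eval_word_closed:
  assumes "set w \<subseteq> carrier G \<times> UNIV"
  shows "eval_word G w \<in> carrier G"
  using assms by (induction w) auto

lemma eval_word_append:
  assumes "set v \<subseteq> carrier G \<times> UNIV" "set w \<subseteq> carrier G \<times> UNIV"
  shows "eval_word G (v @ w) = eval_word G v \<otimes> eval_word G w"
  using assms by (induction v) (auto simp: eval_word_closed m_assoc)

lemma eval_word_inverse:
  assumes "set w \<subseteq> carrier G \<times> UNIV"
  shows "eval_word G (rev (map (\<lambda>(b, s). (b, \<not> s)) w)) = inv (eval_word G w)"
  using assms
proof (induction w)
  case (Cons a w)
  obtain b s where a: "a = (b, s)" by force
  have "set (rev (map (\<lambda>(b, s). (b, \<not> s)) w)) \<subseteq> carrier G \<times> UNIV"
    using Cons.prems by auto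
  then show ?case
    using Cons a by (auto simp: eval_word_append eval_word_closed inv_mult_group)
qed simp

lemma eval_word_cancel:
  assumes "set v \<subseteq> carrier G \<times> UNIV" "b \<in> carrier G" "set w \<subseteq> carrier G \<times> UNIV"
  shows "eval_word G (v @ (b, s) # (b, \<not> s) # w) = eval_word G (v @ w)"
proof -
  have "eval_word G ((b, s) # (b, \<not> s) # w) = eval_word G w"
    using assms by (cases s) (simp_all add: eval_word_closed flip: m_assoc)
  then show ?thesis
    using assms by (simp add: eval_word_append del: eval_word_Cons)
qed

lemma generate_imp_eval_word:
  assumes "B \<subseteq> carrier G" "x \<in> generate G B"
  shows "\<exists>w. set w \<subseteq> B \<times> UNIV \<and> eval_word G w = x"
  using assms(2)
proof induction
  case one
  show ?case by (rule exI[of _ "[]"]) simp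
next
  case (incl b)
  then show ?case using assms(1) by (intro exI[of _ "[(b, True)]"]) auto
next
  case (inv b)
  then show ?case using assms(1) by (intro exI[of _ "[(b, False)]"]) auto
next
  case (eng x y)
  then obtain v w where "set v \<subseteq> B \<times> UNIV" "eval_word G v = x"
    "set w \<subseteq> B \<times> UNIV" "eval_word G w = y" by blast
  moreover from this have "set v \<subseteq> carrier G \<times> UNIV" "set w \<subseteq> carrier G \<times> UNIV"
    using assms(1) by blast+
  ultimately show ?case
    by (intro exI[of _ "v @ w"]) (auto simp: eval_word_append)
qed

end

lemma not_reduced_word_split:
  assumes "\<not> reduced_word w"
  obtains u b s v where "w = u @ (b, s) # (b, \<not> s) # v"
  using assms
proof (induction w arbitrary: thesis rule: induct_list012)
  case (3 p q w)
  obtain b s c t where pq: "p = (b, s)" "q = (c, t)" by (metis surj_pair)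
  show ?case
  proof (cases "b = c \<and> s \<noteq> t")
    case True
    then show ?thesis using "3.prems"(1)[of "[]" b s w] pq by auto
  next
    case False
    then have "\<not> reduced_word (q # w)"
      using "3.prems"(2) pq by (simp add: reduced_word_def)
    then obtain u b s v where "q # w = u @ (b, s) # (b, \<not> s) # v"
      using "3.IH"(2) by blast
    then show ?thesis using "3.prems"(1)[of "p # u" b s v] by simp
  qed
qed (simp_all add: reduced_word_def)

text \<open>A word that is trivial in \<open>G\<close> cannot be reduced and nonempty, so it shrinks to the empty word by
  cancelling adjacent inverse letters. The same cancellations work after substituting \<open>\<phi>\<close>.\<close>

lemma eval_word_eq_one_transfer:
  assumes "group G" "group H" "free_basis G B" "\<phi> \<in> B \<rightarrow> carrier H"
    and "set w \<subseteq> B \<times> UNIV" "eval_word G w = \<one>\<^bsub>G\<^esub>"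
  shows "eval_word H (map (apfst \<phi>) w) = \<one>\<^bsub>H\<^esub>"
  using assms(5,6)
proof (induction w rule: length_induct)
  case (1 w)
  interpret G: group G by fact
  interpret H: group H by fact
  have B: "B \<subseteq> carrier G" using assms(3) by (simp add: free_basis_def)
  show ?case
  proof (cases "reduced_word w")
    case True
    then have "w = []" using assms(3) "1.prems" by (auto simp: free_basis_def)
    then show ?thesis by simp
  next
    case False
    then obtain u b s v where w: "w = u @ (b, s) # (b, \<not> s) # v"
      by (rule not_reduced_word_split)
    have sub: "set u \<subseteq> B \<times> UNIV" "set v \<subseteq> B \<times> UNIV" "b \<in> B"
      using "1.prems"(1) w by auto
    have subG: "set u \<subseteq> carrier G \<times> UNIV" "set v \<subseteq> carrier G \<times> UNIV" "b \<in> carrier G"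
      using sub B by blast+
    have subH: "set (map (apfst \<phi>) u) \<subseteq> carrier H \<times> UNIV"
      "set (map (apfst \<phi>) v) \<subseteq> carrier H \<times> UNIV" "\<phi> b \<in> carrier H"
      using sub assms(4) by fastforce+
    have "eval_word G (u @ v) = \<one>\<^bsub>G\<^esub>"
      using "1.prems"(2) G.eval_word_cancel[OF subG(1,3,2)] w by simp
    then have "eval_word H (map (apfst \<phi>) (u @ v)) = \<one>\<^bsub>H\<^esub>"
      by (intro "1.IH"[rule_format]) (use sub w in auto)
    then show ?thesis
      using H.eval_word_cancel[OF subH(1,3,2)] w by simp
  qed
qed

text \<open>The universal property of a free basis. An element is sent to the value in \<open>H\<close> of any word that
  represents it; two choices \<open>v\<close>, \<open>w\<close> agree because \<open>v\<close> followed by the formal inverse of \<open>w\<close> is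
  trivial in \<open>G\<close>, hence in \<open>H\<close>.\<close>

theorem free_basis_extend_hom:
  assumes "group G" "group H" "free_basis G B" "\<phi> \<in> B \<rightarrow> carrier H"
  obtains h where "h \<in> hom G H" "\<And>b. b \<in> B \<Longrightarrow> h b = \<phi> b"
proof -
  interpret G: group G by fact
  interpret H: group H by fact
  have B: "B \<subseteq> carrier G" "generate G B = carrier G" using assms(3) by (auto simp: free_basis_def)
  define W where "W = {w. set w \<subseteq> B \<times> (UNIV :: bool set)}"
  define E where "E w = eval_word H (map (apfst \<phi>) w)" for w
  have WG: "set w \<subseteq> carrier G \<times> UNIV" and WH: "set (map (apfst \<phi>) w) \<subseteq> carrier H \<times> UNIV"
    if "w \<in> W" for w
    using that B assms(4) by (fastforce simp: W_def)+
  have E_closed: "E w \<in> carrier H" if "w \<in> W" for w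
    unfolding E_def using WH[OF that] by (rule H.eval_word_closed)
  have E_append: "E (v @ w) = E v \<otimes>\<^bsub>H\<^esub> E w" if "v \<in> W" "w \<in> W" for v w
    unfolding E_def map_append using WH that by (blast intro: H.eval_word_append)
  have E_cong: "E v = E w" if vw: "v \<in> W" "w \<in> W" "eval_word G v = eval_word G w" for v w
  proof -
    define w' where "w' = rev (map (\<lambda>(b, s). (b, \<not> s)) w)"
    have w': "w' \<in> W" using vw by (auto simp: W_def w'_def)
    have "map (apfst \<phi>) w' = rev (map (\<lambda>(b, s). (b, \<not> s)) (map (apfst \<phi>) w))"
      by (simp add: w'_def rev_map split_def apfst_def map_prod_def)
    then have Ew': "E w' = inv\<^bsub>H\<^esub> E w"
      using H.eval_word_inverse WH vw(2) unfolding E_def by metis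
    have "eval_word G (v @ w') = \<one>\<^bsub>G\<^esub>"
      using G.eval_word_append[OF WG[OF vw(1)] WG[OF w']] G.eval_word_inverse[OF WG[OF vw(2)]]
        vw(3) G.eval_word_closed[OF WG[OF vw(2)]] by (simp flip: w'_def)
    then have "E (v @ w') = \<one>\<^bsub>H\<^esub>"
      unfolding E_def using vw(1) w'
      by (intro eval_word_eq_one_transfer[OF assms]) (auto simp: W_def)
    then show ?thesis
      using E_append[OF vw(1) w'] Ew' E_closed vw(1,2) by (metis H.inv_equality H.inv_inv H.inv_closed)
  qed
  define h where "h x = E (SOME w. w \<in> W \<and> eval_word G w = x)" for x
  have h_eval: "h (eval_word G w) = E w" if "w \<in> W" for w
  proof -
    have "(SOME v. v \<in> W \<and> eval_word G v = eval_word G w) \<in> W \<and>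
      eval_word G (SOME v. v \<in> W \<and> eval_word G v = eval_word G w) = eval_word G w"
      by (rule someI) (use that in simp)
    then show ?thesis unfolding h_def using E_cong that by blast
  qed
  have word: "\<exists>w\<in>W. eval_word G w = x" if "x \<in> carrier G" for x
    using G.generate_imp_eval_word[OF B(1)] that B(2) by (auto simp: W_def)
  show thesis
  proof
    show "h \<in> hom G H"
    proof (rule homI)
      fix x assume "x \<in> carrier G"
      then show "h x \<in> carrier H" using word h_eval E_closed by metis
    next
      fix x y assume "x \<in> carrier G" "y \<in> carrier G"
      then obtain v w where vw: "v \<in> W" "w \<in> W" "x = eval_word G v" "y = eval_word G w"
        using word by metis
      have "h (x \<otimes>\<^bsub>G\<^esub> y) = h (eval_word G (v @ w))"
        using vw WG by (simp add: G.eval_word_append)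
      also have "\<dots> = E v \<otimes>\<^bsub>H\<^esub> E w"
        using vw E_append h_eval[of "v @ w"] by (auto simp: W_def)
      finally show "h (x \<otimes>\<^bsub>G\<^esub> y) = h x \<otimes>\<^bsub>H\<^esub> h y" using vw h_eval by simp
    qed
  next
    fix b assume b: "b \<in> B"
    then have "b = eval_word G [(b, True)]" "[(b, True)] \<in> W" using B by (auto simp: W_def)
    then have "h b = E [(b, True)]" using h_eval by metis
    moreover have "\<phi> b \<in> carrier H" using b assms(4) by blast
    ultimately show "h b = \<phi> b" by (simp add: E_def)
  qed
qed

section \<open>Derivations, and a product that lies in no free basis\<close>

text \<open>The pair \<open>(c, t)\<close> is the affine map \<open>z \<mapsto> c z + t\<close> of the real line, and the product is composition.\<close>

definition affine_group :: "(real \<times> real) monoid" where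
  "affine_group =
     \<lparr> carrier = {(c, t). c \<noteq> 0},
       mult = (\<lambda>(c, t) (c', t'). (c * c', t + c * t')),
       one = (1, 0) \<rparr>"

lemma group_affine_group: "group affine_group"
proof (rule groupI)
  fix x assume "x \<in> carrier affine_group"
  then show "\<exists>y\<in>carrier affine_group. y \<otimes>\<^bsub>affine_group\<^esub> x = \<one>\<^bsub>affine_group\<^esub>"
    by (intro bexI[of _ "(1 / fst x, - snd x / fst x)"])
      (auto simp: affine_group_def split: prod.splits)
qed (auto simp: affine_group_def algebra_simps)

text \<open>A derivation \<open>d\<close> with respect to \<open>\<rho>\<close> is the translation part of a homomorphism into the affine group
  whose linear part is \<open>\<rho>\<close>. The universal property gives one with any translation parts on \<open>B\<close>.\<close>

theorem free_basis_derivation: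
  fixes \<rho> :: "'a \<Rightarrow> real"
  assumes "group G" "free_basis G B" "g \<in> B"
    and mult: "\<And>x y. x \<in> carrier G \<Longrightarrow> y \<in> carrier G \<Longrightarrow> \<rho> (x \<otimes>\<^bsub>G\<^esub> y) = \<rho> x * \<rho> y"
    and nz: "\<And>x. x \<in> carrier G \<Longrightarrow> \<rho> x \<noteq> 0"
  obtains d :: "'a \<Rightarrow> real" where "d g = 1"
    "\<And>x y. x \<in> carrier G \<Longrightarrow> y \<in> carrier G \<Longrightarrow> d (x \<otimes>\<^bsub>G\<^esub> y) = d x + \<rho> x * d y"
proof -
  interpret G: group G by fact
  have B: "B \<subseteq> carrier G" "generate G B = carrier G" using assms(2) by (auto simp: free_basis_def)
  define \<phi> where "\<phi> b = (\<rho> b, if b = g then 1 else 0 :: real)" for b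
  have "\<phi> \<in> B \<rightarrow> carrier affine_group"
    using B nz by (auto simp: \<phi>_def affine_group_def)
  then obtain h where h: "h \<in> hom G affine_group" and hB: "\<And>b. b \<in> B \<Longrightarrow> h b = \<phi> b"
    using free_basis_extend_hom[OF assms(1) group_affine_group assms(2)] by blast
  have hm: "fst (h (x \<otimes>\<^bsub>G\<^esub> y)) = fst (h x) * fst (h y)"
    "snd (h (x \<otimes>\<^bsub>G\<^esub> y)) = snd (h x) + fst (h x) * snd (h y)"
    if "x \<in> carrier G" "y \<in> carrier G" for x y
    using hom_mult[OF h that] by (auto simp: affine_group_def split_def)
  have one: "\<rho> \<one>\<^bsub>G\<^esub> = 1" using mult[of "\<one>\<^bsub>G\<^esub>" "\<one>\<^bsub>G\<^esub>"] nz[of "\<one>\<^bsub>G\<^esub>"] by simp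
  have h1: "h \<one>\<^bsub>G\<^esub> = (1, 0)"
    using hom_one[OF h assms(1) group_affine_group] by (simp add: affine_group_def)
  have fst_h: "fst (h x) = \<rho> x" if "x \<in> carrier G" for x
    using that unfolding B(2)[symmetric]
  proof induction
    case (inv b)
    then have b: "b \<in> carrier G" using B by blast
    have "fst (h (inv\<^bsub>G\<^esub> b)) * \<rho> b = \<rho> (inv\<^bsub>G\<^esub> b) * \<rho> b"
      using hm(1)[of "inv\<^bsub>G\<^esub> b" b] mult[of "inv\<^bsub>G\<^esub> b" b] hB[OF inv] b one h1
      by (simp add: \<phi>_def)
    then show ?case using nz[OF b] by simp
  next
    case (eng x y)
    then show ?case using hm mult B by simp
  qed (use h1 one hB in \<open>auto simp: \<phi>_def\<close>)
  show thesis
    by (rule that[of "snd \<circ> h"]) (use hB[OF assms(3)] hm fst_h in \<open>auto simp: \<phi>_def\<close>)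
qed

text \<open>Every derivation maps the telescoping product to \<open>d (Y N) - d (Y 0)\<close>, which the conjugation relation
  turns into \<open>- d t\<close>, so it kills \<open>F N \<otimes> t\<close>. The value \<open>2\<close> of \<open>\<rho>\<close> is essential: if \<open>\<rho> (Y k) = c\<close> for all \<open>k\<close>, the computation gives
  \<open>d (F N \<otimes> t) = (2 - c) d t\<close>.\<close>

theorem telescoping_product_not_in_free_basis:
  fixes G (structure) and \<rho> :: "'a \<Rightarrow> real"
  assumes "group G"
    and mult: "\<And>x y. x \<in> carrier G \<Longrightarrow> y \<in> carrier G \<Longrightarrow> \<rho> (x \<otimes> y) = \<rho> x * \<rho> y"
    and nz: "\<And>x. x \<in> carrier G \<Longrightarrow> \<rho> x \<noteq> 0"
    and Y: "\<And>k. k \<le> N \<Longrightarrow> Y k \<in> carrier G" "\<And>k. k \<le> N \<Longrightarrow> \<rho> (Y k) = 2"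
    and t: "t \<in> carrier G" "\<rho> t = 1" "Y N \<otimes> t = t \<otimes> Y 0"
    and F: "F 0 = \<one>" "\<And>k. k < N \<Longrightarrow> F (Suc k) = F k \<otimes> Y (Suc k) \<otimes> inv (Y k)"
    and "free_basis G B"
  shows "F N \<otimes> t \<notin> B"
proof
  interpret group G by fact
  assume "F N \<otimes> t \<in> B"
  then obtain d :: "'a \<Rightarrow> real" where d1: "d (F N \<otimes> t) = 1"
    and d: "\<And>x y. x \<in> carrier G \<Longrightarrow> y \<in> carrier G \<Longrightarrow> d (x \<otimes> y) = d x + \<rho> x * d y"
    using free_basis_derivation[OF assms(1) \<open>free_basis G B\<close>, of _ \<rho>] mult nz by metis
  have \<rho>1: "\<rho> \<one> = 1" using mult[of \<one> \<one>] nz[of \<one>] by simp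
  have d_one: "d \<one> = 0" using d[of \<one> \<one>] \<rho>1 by simp
  have \<rho>_inv: "\<rho> (inv x) = 1 / \<rho> x" and d_inv: "d (inv x) = - d x / \<rho> x"
    if x: "x \<in> carrier G" for x
  proof -
    show "\<rho> (inv x) = 1 / \<rho> x"
      using mult[of x "inv x"] \<rho>1 x nz[OF x] by (simp add: field_simps)
    show "d (inv x) = - d x / \<rho> x"
      using d[of x "inv x"] d_one x nz[OF x] by (simp add: field_simps)
  qed
  have "F k \<in> carrier G \<and> \<rho> (F k) = 1 \<and> d (F k) = d (Y k) - d (Y 0)" if "k \<le> N" for k
    using that
  proof (induction k)
    case (Suc k)
    then have Yk: "Y k \<in> carrier G" "Y (Suc k) \<in> carrier G" "\<rho> (Y k) = 2" "\<rho> (Y (Suc k)) = 2"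
      using Y by auto
    with Suc show ?case by (simp add: F(2) mult d \<rho>_inv d_inv)
  qed (simp add: F \<rho>1 d_one)
  from this[of N] have "d (F N \<otimes> t) = d (Y N) - d (Y 0) + d t" using t d by simp
  moreover have "d (Y N) + 2 * d t = d t + d (Y 0)"
    using d[of "Y N" t] d[of t "Y 0"] Y t by simp
  ultimately show False using d1 by simp
qed

section \<open>The fundamental group of a subset of a normed space\<close>

lemma loop_at_iff:
  "loop_at (top_of_set S) x p \<longleftrightarrow>
     path p \<and> path_image p \<subseteq> S \<and> pathstart p = x \<and> pathfinish p = x"
  by (auto simp: loop_at_def pathin_def path_def path_image_def pathstart_def pathfinish_def
      continuous_map_in_subtopology)

lemma loop_class_eq:
  assumes "loop_at (top_of_set S) x p"
  shows "loop_class (top_of_set S) x p = {q. homotopic_paths S p q}"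
  using assms by (simp add: loop_class_def homotopic_paths_def loop_at_def pathstart_def pathfinish_def)

lemma loop_class_eq_iff:
  assumes "loop_at (top_of_set S) x p" "loop_at (top_of_set S) x q"
  shows "loop_class (top_of_set S) x p = loop_class (top_of_set S) x q \<longleftrightarrow> homotopic_paths S p q"
proof -
  have q: "homotopic_paths S q q" using assms(2) by (simp add: loop_at_iff)
  have *: "homotopic_paths S p r \<longleftrightarrow> homotopic_paths S q r" if "homotopic_paths S p q" for r
    by (rule iffI) (erule homotopic_paths_trans[OF homotopic_paths_sym[OF that]]
        homotopic_paths_trans[OF that])+
  show ?thesis
    unfolding loop_class_eq[OF assms(1)] loop_class_eq[OF assms(2)]
  proof
    assume "{r. homotopic_paths S p r} = {r. homotopic_paths S q r}"
    with q have "q \<in> {r. homotopic_paths S p r}" by simp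
    then show "homotopic_paths S p q" by simp
  next
    assume "homotopic_paths S p q"
    then show "{r. homotopic_paths S p r} = {r. homotopic_paths S q r}" by (simp add: *)
  qed
qed

lemma loop_at_homotopic:
  assumes "loop_at (top_of_set S) x p" "homotopic_paths S p q"
  shows "loop_at (top_of_set S) x q"
  using assms homotopic_paths_imp_path homotopic_paths_imp_subset homotopic_paths_imp_pathstart
    homotopic_paths_imp_pathfinish by (metis loop_at_iff)

lemma loop_at_join:
  assumes "loop_at (top_of_set S) x p" "loop_at (top_of_set S) x q"
  shows "loop_at (top_of_set S) x (p +++ q)"
  using assms by (auto simp: loop_at_iff path_image_join)

lemma loop_at_const:
  assumes "x \<in> S"
  shows "loop_at (top_of_set S) x (\<lambda>_. x)"
  using assms by (auto simp: loop_at_iff path_def path_image_def pathstart_def pathfinish_def)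

lemma carrier_fundamental_group:
  "carrier (fundamental_group X x) = loop_class X x ` {p. loop_at X x p}"
  by (simp add: fundamental_group_def)

lemma one_fundamental_group: "\<one>\<^bsub>fundamental_group X x\<^esub> = loop_class X x (\<lambda>_. x)"
  by (simp add: fundamental_group_def)

text \<open>Multiplication is a union over representatives; all members of the union coincide since joining
  respects homotopy.\<close>

lemma mult_fundamental_group:
  assumes p: "loop_at (top_of_set S) x p" and q: "loop_at (top_of_set S) x q"
  shows "loop_class (top_of_set S) x p \<otimes>\<^bsub>fundamental_group (top_of_set S) x\<^esub> loop_class (top_of_set S) x q
    = loop_class (top_of_set S) x (p +++ q)"
proof -
  let ?C = "loop_class (top_of_set S) x"
  have *: "?C (p' +++ q') = ?C (p +++ q)"
    if p': "homotopic_paths S p p'" and q': "homotopic_paths S q q'" for p' q'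
  proof -
    have "homotopic_paths S (p +++ q) (p' +++ q')"
      using p q by (intro homotopic_paths_join p' q') (simp add: loop_at_iff)
    then have "homotopic_paths S (p' +++ q') (p +++ q)" by (rule homotopic_paths_sym)
    moreover have "loop_at (top_of_set S) x (p' +++ q')" "loop_at (top_of_set S) x (p +++ q)"
      by (intro loop_at_join loop_at_homotopic[OF p p'] loop_at_homotopic[OF q q'] p q)+
    ultimately show ?thesis by (subst loop_class_eq_iff)
  qed
  have "homotopic_paths S p p" "homotopic_paths S q q" using p q by (simp_all add: loop_at_iff)
  then have "(\<Union>p'\<in>{r. homotopic_paths S p r}. \<Union>q'\<in>{r. homotopic_paths S q r}. ?C (p' +++ q')) = ?C (p +++ q)"
    using * by blast
  then show ?thesis
    by (simp add: fundamental_group_def loop_class_eq[OF p] loop_class_eq[OF q])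
qed

theorem group_fundamental_group:
  fixes S :: "'a::real_normed_vector set"
  assumes "x \<in> S"
  shows "group (fundamental_group (top_of_set S) x)" (is "group ?G")
proof (rule groupI)
  let ?X = "top_of_set S"
  have const: "(\<lambda>_. x) = linepath x x" by (simp add: linepath_refl fun_eq_iff)
  {
    fix a b assume "a \<in> carrier ?G" "b \<in> carrier ?G"
    then show "a \<otimes>\<^bsub>?G\<^esub> b \<in> carrier ?G"
      by (auto simp: carrier_fundamental_group mult_fundamental_group intro: loop_at_join)
  next
    show "\<one>\<^bsub>?G\<^esub> \<in> carrier ?G"
      using loop_at_const[OF assms] by (auto simp: carrier_fundamental_group one_fundamental_group)
  next
    fix a b c assume "a \<in> carrier ?G" "b \<in> carrier ?G" "c \<in> carrier ?G"
    then obtain p q r where pqr: "loop_at ?X x p" "loop_at ?X x q" "loop_at ?X x r"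
      "a = loop_class ?X x p" "b = loop_class ?X x q" "c = loop_class ?X x r"
      by (auto simp: carrier_fundamental_group)
    have "homotopic_paths S ((p +++ q) +++ r) (p +++ (q +++ r))"
      using pqr homotopic_paths_sym[OF homotopic_paths_assoc[of p S q r]] by (auto simp: loop_at_iff)
    then show "a \<otimes>\<^bsub>?G\<^esub> b \<otimes>\<^bsub>?G\<^esub> c = a \<otimes>\<^bsub>?G\<^esub> (b \<otimes>\<^bsub>?G\<^esub> c)"
      using pqr by (simp add: mult_fundamental_group loop_at_join loop_class_eq_iff)
  next
    fix a assume "a \<in> carrier ?G"
    then obtain p where p: "loop_at ?X x p" "a = loop_class ?X x p"
      by (auto simp: carrier_fundamental_group)
    have "homotopic_paths S ((\<lambda>_. x) +++ p) p"
      unfolding const using p homotopic_paths_lid[of p S] by (auto simp: loop_at_iff)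
    then show "\<one>\<^bsub>?G\<^esub> \<otimes>\<^bsub>?G\<^esub> a = a"
      using p loop_at_const[OF assms]
      by (simp add: one_fundamental_group mult_fundamental_group loop_at_join loop_class_eq_iff)
    have r: "loop_at ?X x (reversepath p)" using p by (auto simp: loop_at_iff)
    have "homotopic_paths S (reversepath p +++ p) (\<lambda>_. x)"
      unfolding const using p homotopic_paths_linv[of p S] by (auto simp: loop_at_iff)
    then have "loop_class ?X x (reversepath p) \<otimes>\<^bsub>?G\<^esub> a = \<one>\<^bsub>?G\<^esub>"
      using p r loop_at_const[OF assms]
      by (simp add: one_fundamental_group mult_fundamental_group loop_at_join loop_class_eq_iff)
    then show "\<exists>b\<in>carrier ?G. b \<otimes>\<^bsub>?G\<^esub> a = \<one>\<^bsub>?G\<^esub>"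
      using r by (auto simp: carrier_fundamental_group)
  }
qed

text \<open>A path \<open>r\<close> between two points becomes a loop at the base point by a path \<open>e\<close> to its start and the
  reverse of a path \<open>e'\<close> to its end.\<close>

definition tether :: "(real \<Rightarrow> 'a::topological_space) \<Rightarrow> (real \<Rightarrow> 'a) \<Rightarrow> (real \<Rightarrow> 'a) \<Rightarrow> real \<Rightarrow> 'a" where
  "tether e r e' = e +++ (r +++ reversepath e')"

definition path_from_to :: "'a::topological_space set \<Rightarrow> 'a \<Rightarrow> 'a \<Rightarrow> (real \<Rightarrow> 'a) \<Rightarrow> bool" where
  "path_from_to S v w p \<longleftrightarrow> path p \<and> path_image p \<subseteq> S \<and> pathstart p = v \<and> pathfinish p = w"

lemma path_from_to_join:
  "path_from_to S u v p \<Longrightarrow> path_from_to S v w q \<Longrightarrow> path_from_to S u w (p +++ q)"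
  by (auto simp: path_from_to_def path_image_join)

lemma path_from_to_reversepath:
  "path_from_to S u v p \<Longrightarrow> path_from_to S v u (reversepath p)"
  by (auto simp: path_from_to_def)

lemma loop_at_tether:
  assumes "path_from_to S x v e" "path_from_to S v w r" "path_from_to S x w e'"
  shows "loop_at (top_of_set S) x (tether e r e')"
  using assms by (auto simp: loop_at_iff tether_def path_from_to_def path_image_join)

lemma homotopic_paths_cancel_middle:
  fixes S :: "'a::real_normed_vector set"
  assumes "path_from_to S u v e" "path_from_to S v w q"
  shows "homotopic_paths S (reversepath e +++ (e +++ q)) q"
proof -
  have "homotopic_paths S (reversepath e +++ (e +++ q)) ((reversepath e +++ e) +++ q)"
    using assms by (intro homotopic_paths_assoc) (auto simp: path_from_to_def)
  also have "homotopic_paths S ((reversepath e +++ e) +++ q) (linepath v v +++ q)"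
    using assms homotopic_paths_linv[of e S]
    by (intro homotopic_paths_join) (auto simp: path_from_to_def)
  also have "homotopic_paths S (linepath v v +++ q) q"
    using assms homotopic_paths_lid[of q S] by (auto simp: path_from_to_def)
  finally show ?thesis .
qed

lemma homotopic_paths_join_left:
  assumes "path_from_to S u v p" "path_from_to S v w q" "homotopic_paths S q q'"
  shows "homotopic_paths S (p +++ q) (p +++ q')"
  using assms by (intro homotopic_paths_join) (auto simp: path_from_to_def)

lemma homotopic_paths_assoc':
  fixes S :: "'a::real_normed_vector set"
  assumes "path_from_to S a b p" "path_from_to S b c q" "path_from_to S c d r"
  shows "homotopic_paths S ((p +++ q) +++ r) (p +++ (q +++ r))"
  using assms homotopic_paths_sym[OF homotopic_paths_assoc[of p S q r]] by (auto simp: path_from_to_def)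

text \<open>In the middle of the product, the path runs back along \<open>e'\<close> and out again; this detour contracts.\<close>

lemma tether_join:
  fixes S :: "'a::real_normed_vector set"
  assumes e: "path_from_to S x u e" "path_from_to S x v e'" "path_from_to S x w e''"
    and r: "path_from_to S u v r" "path_from_to S v w r'"
  shows "loop_class (top_of_set S) x (tether e r e')
      \<otimes>\<^bsub>fundamental_group (top_of_set S) x\<^esub> loop_class (top_of_set S) x (tether e' r' e'')
    = loop_class (top_of_set S) x (tether e (r +++ r') e'')"
proof -
  note j = path_from_to_join path_from_to_reversepath e r
  let ?t = "r' +++ reversepath e''"
  have t: "path_from_to S v x ?t" by (rule j | assumption)+
  have "homotopic_paths S ((e +++ (r +++ reversepath e')) +++ (e' +++ ?t))
      (e +++ ((r +++ reversepath e') +++ (e' +++ ?t)))"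
    by (rule homotopic_paths_assoc') (rule j t)+
  also have "homotopic_paths S \<dots> (e +++ (r +++ (reversepath e' +++ (e' +++ ?t))))"
    by (rule homotopic_paths_join_left, rule j, (rule j t)+, rule homotopic_paths_assoc') (rule j t)+
  also have "homotopic_paths S \<dots> (e +++ (r +++ ?t))"
    by (rule homotopic_paths_join_left, rule j, (rule j t)+, rule homotopic_paths_join_left, rule j,
        (rule j t)+, rule homotopic_paths_cancel_middle) (rule j t)+
  also have "homotopic_paths S \<dots> (e +++ ((r +++ r') +++ reversepath e''))"
    by (rule homotopic_paths_join_left, rule j, (rule j t)+, rule homotopic_paths_sym,
        rule homotopic_paths_assoc') (rule j t)+
  finally have "homotopic_paths S (tether e r e' +++ tether e' r' e'') (tether e (r +++ r') e'')"
    by (simp add: tether_def)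
  moreover have "loop_at (top_of_set S) x (tether e r e')" "loop_at (top_of_set S) x (tether e' r' e'')"
    "loop_at (top_of_set S) x (tether e (r +++ r') e'')"
    by (rule loop_at_tether, (rule e r path_from_to_join)+)+
  ultimately show ?thesis
    by (simp add: mult_fundamental_group loop_class_eq_iff loop_at_join)
qed

lemma tether_cong:
  fixes S :: "'a::real_normed_vector set"
  assumes "path_from_to S x v e" "path_from_to S v w r" "path_from_to S x w e'"
    and "homotopic_paths S r r'"
  shows "loop_class (top_of_set S) x (tether e r e') = loop_class (top_of_set S) x (tether e r' e')"
proof -
  have "path_from_to S v w r'"
    using assms(2,4) homotopic_paths_imp_path homotopic_paths_imp_subset
      homotopic_paths_imp_pathstart homotopic_paths_imp_pathfinish by (metis path_from_to_def)
  then have "loop_at (top_of_set S) x (tether e r e')" "loop_at (top_of_set S) x (tether e r' e')"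
    using assms loop_at_tether by blast+
  moreover have "homotopic_paths S (tether e r e') (tether e r' e')"
    unfolding tether_def using assms
    by (intro homotopic_paths_join) (auto simp: path_from_to_def)
  ultimately show ?thesis by (simp add: loop_class_eq_iff)
qed

text \<open>A nonvanishing complex function \<open>h\<close> on \<open>S\<close> pulls the winding number around \<open>0\<close> back to a homomorphism
  from the fundamental group to the additive group of complex numbers.\<close>

lemma winding_number_fundamental_group:
  fixes h :: "'a::real_normed_vector \<Rightarrow> complex"
  assumes "x \<in> S" and h: "continuous_on S h" "0 \<notin> h ` S"
  obtains \<omega> :: "(real \<Rightarrow> 'a) set \<Rightarrow> complex" where
    "\<And>p. loop_at (top_of_set S) x p \<Longrightarrow> \<omega> (loop_class (top_of_set S) x p) = winding_number (h \<circ> p) 0"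
    "\<And>a b. a \<in> carrier (fundamental_group (top_of_set S) x) \<Longrightarrow>
       b \<in> carrier (fundamental_group (top_of_set S) x) \<Longrightarrow>
       \<omega> (a \<otimes>\<^bsub>fundamental_group (top_of_set S) x\<^esub> b) = \<omega> a + \<omega> b"
proof
  define \<omega> where "\<omega> a = winding_number (h \<circ> (SOME p. p \<in> a)) 0" for a
  show *: "\<omega> (loop_class (top_of_set S) x p) = winding_number (h \<circ> p) 0"
    if p: "loop_at (top_of_set S) x p" for p
  proof -
    let ?q = "SOME q. q \<in> loop_class (top_of_set S) x p"
    have "p \<in> loop_class (top_of_set S) x p"
      using p by (simp add: loop_class_eq) (simp add: loop_at_iff)
    then have "?q \<in> loop_class (top_of_set S) x p"
      using someI[of "\<lambda>q. q \<in> loop_class (top_of_set S) x p"] by blast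
    then have "homotopic_paths S p ?q" using p by (simp add: loop_class_eq)
    then have "homotopic_paths (-{0}) (h \<circ> p) (h \<circ> ?q)"
      using h by (rule_tac homotopic_paths_continuous_image) auto
    then show ?thesis by (simp add: \<omega>_def winding_number_homotopic_paths)
  qed
  fix a b assume "a \<in> carrier (fundamental_group (top_of_set S) x)"
       "b \<in> carrier (fundamental_group (top_of_set S) x)"
  then obtain p q where p: "loop_at (top_of_set S) x p" "loop_at (top_of_set S) x q"
      "a = loop_class (top_of_set S) x p" "b = loop_class (top_of_set S) x q"
    by (auto simp: carrier_fundamental_group)
  have hp: "path (h \<circ> r)" "0 \<notin> path_image (h \<circ> r)" if "loop_at (top_of_set S) x r" for r
    using that h continuous_on_subset[OF h(1)]
    by (auto simp: loop_at_iff path_image_compose intro!: path_continuous_image)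
  have "winding_number (h \<circ> (p +++ q)) 0 = winding_number (h \<circ> p) 0 + winding_number (h \<circ> q) 0"
    unfolding path_compose_join using p hp
    by (intro winding_number_join) (auto simp: loop_at_iff pathstart_compose pathfinish_compose)
  then show "\<omega> (a \<otimes>\<^bsub>fundamental_group (top_of_set S) x\<^esub> b) = \<omega> a + \<omega> b"
    using p * by (simp add: mult_fundamental_group loop_at_join)
qed

lemma winding_number_tether_const:
  assumes "path r" "0 \<notin> path_image r" "pathstart r = 1" "pathfinish r = 1"
  shows "winding_number (tether (\<lambda>_. 1) r (\<lambda>_. 1)) 0 = winding_number r 0"
proof -
  have c: "(\<lambda>_. 1) = linepath 1 (1 :: complex)" by (simp add: linepath_refl fun_eq_iff)
  have "reversepath (linepath 1 1) = linepath 1 (1 :: complex)" by simp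
  then show ?thesis
    using assms unfolding tether_def c by (simp add: winding_number_join not_in_path_image_join)
qed

section \<open>Finite graphs\<close>

text \<open>With finitely many edges, two conditions of a graph structure are automatic. The weak topology
  condition holds since the closed edges are finitely many closed sets that cover the space. An edge is
  a closed map, being continuous from a compact to a Hausdorff space, and the open interval is the
  whole preimage of the open cell, so the restriction is an embedding even if the edge is a loop.\<close>

lemma finite_graph_structureI:
  assumes "Hausdorff_space X" "finite E" "E \<noteq> {}"
    and path: "\<And>e. e \<in> E \<Longrightarrow> pathin X e" and ends: "\<And>e. e \<in> E \<Longrightarrow> e 0 \<in> V \<and> e 1 \<in> V"
    and inj: "\<And>e. e \<in> E \<Longrightarrow> inj_on e {0<..<1}"
    and disj: "\<And>e. e \<in> E \<Longrightarrow> disjnt (e ` {0<..<1}) V"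
    and pw: "pairwise (\<lambda>e e'. disjnt (e ` {0<..<1}) (e' ` {0<..<1})) E"
    and V: "V \<subseteq> (\<Union>e\<in>E. e ` {0..1})"
    and top: "topspace X = V \<union> (\<Union>e\<in>E. e ` {0<..<1})"
  shows "graph_structure X V E"
proof -
  have cont: "continuous_map (top_of_set {0..1}) X e" if "e \<in> E" for e
    using path[OF that] by (simp add: pathin_def)
  have closed: "closed_map (top_of_set {0..1}) X e" if "e \<in> E" for e
    using cont[OF that] assms(1)
    by (intro T1_Spaces.continuous_imp_closed_map) (auto simp: compact_space_subtopology)
  have emb: "embedding_map (top_of_set {0<..<1}) X e" if e: "e \<in> E" for e
  proof -
    let ?W = "e ` {0<..<1::real}"
    have sub: "subtopology (top_of_set {0..1}) {0<..<1::real} = top_of_set {0<..<1}"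
      by (simp add: subtopology_subtopology Int_absorb1 greaterThanLessThan_subseteq_atLeastAtMost_iff)
    have "{t \<in> topspace (top_of_set {0..1}). e t \<in> ?W} = {0<..<1}"
    proof safe
      fix t t' :: real assume t: "t \<in> topspace (top_of_set {0..1})" "e t = e t'" "t' \<in> {0<..<1}"
      then have "e t \<notin> V" using disj[OF e] by (auto simp: disjnt_iff)
      then have "t \<noteq> 0" "t \<noteq> 1" using ends[OF e] by auto
      then show "t \<in> {0<..<1}" using t by auto
    qed auto
    from closed_map_restriction[OF closed[OF e] this]
    have "closed_map (top_of_set {0<..<1}) (subtopology X ?W) e" by (simp add: sub)
    moreover have "continuous_map (top_of_set {0<..<1}) (subtopology X ?W) e"
      using continuous_map_from_subtopology[OF cont[OF e], of "{0<..<1}"]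
      by (simp add: sub continuous_map_in_subtopology)
    ultimately have "embedding_map (top_of_set {0<..<1}) (subtopology X ?W) e"
      using inj[OF e] by (intro injective_closed_imp_embedding_map) auto
    then show ?thesis by (simp add: embedding_map_in_subtopology)
  qed
  have weak: "closedin X A \<longleftrightarrow> (\<forall>e\<in>E. closedin X (A \<inter> e ` {0..1}))" if A: "A \<subseteq> topspace X" for A
  proof
    have "closedin X (e ` {0..1})" if "e \<in> E" for e
      using closed[OF that] by (simp add: closed_map_def)
    then show "closedin X A \<Longrightarrow> \<forall>e\<in>E. closedin X (A \<inter> e ` {0..1})" by blast
  next
    assume *: "\<forall>e\<in>E. closedin X (A \<inter> e ` {0..1})"
    have "(\<Union>e\<in>E. e ` {0<..<1}) \<subseteq> (\<Union>e\<in>E. e ` {0..1})" by (intro UN_mono image_mono) auto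
    then have "A \<subseteq> (\<Union>e\<in>E. e ` {0..1})"
      by (rule order.trans[OF A[unfolded top] Un_least[OF V]])
    then have "A = (\<Union>e\<in>E. A \<inter> e ` {0..1})" by auto
    moreover have "closedin X (\<Union>e\<in>E. A \<inter> e ` {0..1})"
      using * assms(2) by (intro closedin_Union) auto
    ultimately show "closedin X A" by simp
  qed
  show ?thesis
    unfolding graph_structure_def
    by (intro conjI ballI allI impI) (use assms emb weak in \<open>simp_all\<close>)
qed

section \<open>The necklace: a longitude of the torus with meridians attached\<close>

text \<open>The torus in \<open>\<real>\<^sup>3\<close> with core radius \<open>2\<close> and tube radius \<open>1\<close>, as a quotient of the plane with periods
  \<open>N\<close> in the first and \<open>1\<close> in the second coordinate.\<close>

definition torus :: "nat \<Rightarrow> real \<times> real \<Rightarrow> real^3" where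
  "torus N = (\<lambda>(s, u). vector [(2 + cos (2 * pi * u)) * cos (2 * pi * (s / N)),
                              (2 + cos (2 * pi * u)) * sin (2 * pi * (s / N)),
                              sin (2 * pi * u)])"

definition grid :: "(real \<times> real) set" where
  "grid = {(s, u). s \<in> \<int> \<or> u \<in> \<int>}"

definition necklace :: "nat \<Rightarrow> (real^3) set" where
  "necklace N = torus N ` grid"

lemma torus_component:
  "torus N (s, u) $ 1 = (2 + cos (2 * pi * u)) * cos (2 * pi * (s / N))"
  "torus N (s, u) $ 2 = (2 + cos (2 * pi * u)) * sin (2 * pi * (s / N))"
  "torus N (s, u) $ 3 = sin (2 * pi * u)"
  by (simp_all add: torus_def)

text \<open>On the torus, this recovers the position on the meridian circle as a point of the unit circle. It is
  continuous on all of \<open>\<real>\<^sup>3\<close>.\<close>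

definition meridian :: "real^3 \<Rightarrow> complex" where
  "meridian y = Complex (sqrt ((y $ 1)\<^sup>2 + (y $ 2)\<^sup>2) - 2) (y $ 3)"

lemma continuous_torus: "continuous_on A (torus N)"
proof -
  have "\<forall>i. continuous_on A (\<lambda>x. torus N x $ i)"
    unfolding forall_3 torus_def split_def divide_inverse vector_3 by (intro conjI continuous_intros)
  then have "continuous_on A (\<lambda>x. \<chi> i. torus N x $ i)" by (intro continuous_on_vec_lambda) simp
  then show ?thesis by simp
qed

lemma continuous_meridian: "continuous_on A meridian"
  unfolding meridian_def Complex_eq by (intro continuous_intros)

lemma radius_torus: "sqrt ((torus N (s, u) $ 1)\<^sup>2 + (torus N (s, u) $ 2)\<^sup>2) = 2 + cos (2 * pi * u)"
proof -
  have "(torus N (s, u) $ 1)\<^sup>2 + (torus N (s, u) $ 2)\<^sup>2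
    = (2 + cos (2 * pi * u))\<^sup>2 * ((cos (2 * pi * (s / N)))\<^sup>2 + (sin (2 * pi * (s / N)))\<^sup>2)"
    unfolding torus_component by (simp only: power_mult_distrib distrib_left)
  moreover have "2 + cos (2 * pi * u) \<ge> 0" using cos_ge_minus_one[of "2 * pi * u"] by linarith
  ultimately show ?thesis by simp
qed

lemma meridian_torus: "meridian (torus N (s, u)) = cis (2 * pi * u)"
  unfolding meridian_def radius_torus by (simp add: torus_component complex_eq_iff)

lemma torus_eq_iff:
  fixes s u s' u' :: real
  assumes "N > 0"
  shows "torus N (s, u) = torus N (s', u') \<longleftrightarrow>
    (\<exists>m::int. s = s' + real N * m) \<and> (\<exists>n::int. u = u' + n)"
proof -
  have per: "(sin (2 * pi * a) = sin (2 * pi * b) \<and> cos (2 * pi * a) = cos (2 * pi * b))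
    \<longleftrightarrow> (\<exists>n::int. a = b + n)" for a b
  proof -
    have "(2 * pi * a = 2 * pi * b + 2 * pi * n) \<longleftrightarrow> a = b + n" for n :: int
      by (simp flip: distrib_left)
    then show ?thesis using sin_cos_eq_iff[of "2 * pi * a" "2 * pi * b"] by simp
  qed
  have eq: "torus N (s, u) = torus N (s', u') \<longleftrightarrow>
    (sin (2 * pi * (s / N)) = sin (2 * pi * (s' / N)) \<and> cos (2 * pi * (s / N)) = cos (2 * pi * (s' / N))) \<and>
    (sin (2 * pi * u) = sin (2 * pi * u') \<and> cos (2 * pi * u) = cos (2 * pi * u'))" (is "?L \<longleftrightarrow> ?R")
  proof
    assume L: ?L
    have c: "cos (2 * pi * u) = cos (2 * pi * u')"
      using radius_torus[of N s u] radius_torus[of N s' u'] L by simp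
    have "2 + cos (2 * pi * u') \<noteq> 0" using cos_ge_minus_one[of "2 * pi * u'"] by linarith
    then show ?R using torus_component[of N s u] torus_component[of N s' u'] L c by simp
  qed (simp add: torus_def)
  have "s / N = s' / N + m \<longleftrightarrow> s = s' + N * m" for m :: int and s s' :: real
    using assms by (simp add: field_simps)
  then show ?thesis unfolding eq per by simp
qed

lemma torus_periodic:
  assumes "N > 0"
  shows "torus N (s + real N * of_int m, u + of_int n) = torus N (s, u)"
  using torus_eq_iff[OF assms] by blast

text \<open>Every point has first coordinate \<open>i + r\<close> in the fundamental interval \<open>[0, N)\<close>; integrality is kept
  because the period is an integer.\<close>

lemma torus_reduce:
  assumes N: "N > 0"
  obtains i :: nat and r :: real where "i < N" "0 \<le> r" "r < 1" "s \<in> \<int> \<longrightarrow> r = 0"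
    "\<forall>u. torus N (s, u) = torus N (real i + r, u)"
proof -
  define m where "m = \<lfloor>s / real N\<rfloor>"
  define s' where "s' = s - real N * of_int m"
  have "of_int m \<le> s / real N" "s / real N < of_int m + 1" unfolding m_def by linarith+
  then have s': "0 \<le> s'" "s' < real N" using N by (simp_all add: s'_def field_simps)
  have int: "s' \<in> \<int>" if "s \<in> \<int>" using that by (simp add: s'_def)
  show thesis
  proof (rule that[of "nat \<lfloor>s'\<rfloor>" "frac s'"])
    show "nat \<lfloor>s'\<rfloor> < N" using s' by linarith
    show "0 \<le> frac s'" "frac s' < 1" by (simp_all add: frac_lt_1)
    show "s \<in> \<int> \<longrightarrow> frac s' = 0" using int by (simp add: frac_eq_0_iff)
    have "real (nat \<lfloor>s'\<rfloor>) + frac s' = s'" using s'(1) by (simp add: frac_def)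
    then show "\<forall>u. torus N (s, u) = torus N (real (nat \<lfloor>s'\<rfloor>) + frac s', u)"
      using torus_periodic[OF N, of s' m _ 0] by (simp add: s'_def)
  qed
qed

lemma torus_reduce_meridian:
  assumes N: "N > 0"
  shows "torus N (s, u) = torus N (s, frac u)"
  using torus_periodic[OF N, of s 0 "frac u" "\<lfloor>u\<rfloor>"] by (simp add: frac_def)

definition arc_edge :: "nat \<Rightarrow> nat \<Rightarrow> real \<Rightarrow> real^3" where
  "arc_edge N i t = torus N (real i + t, 0)"

definition bead_edge :: "nat \<Rightarrow> nat \<Rightarrow> real \<Rightarrow> real^3" where
  "bead_edge N i t = torus N (real i, t)"

lemma int_in_unit_interval_diff:
  fixes t t' :: real
  assumes "t - t' = of_int n" "\<bar>t - t'\<bar> < 1"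
  shows "n = 0"
  using assms by linarith

text \<open>The first coordinates differ by a multiple of \<open>N\<close>. So \<open>t - t'\<close> is an integer of absolute value less
  than \<open>1\<close>, that is \<open>0\<close>, and then \<open>i - j\<close> is a multiple of \<open>N\<close> of absolute value less than \<open>N\<close>.\<close>

lemma torus_eq_in_cell:
  fixes i j N :: nat and t t' u u' :: real
  assumes "N > 0" "i < N" "j < N" "\<bar>t - t'\<bar> < 1"
    and eq: "torus N (real i + t, u) = torus N (real j + t', u')"
  shows "i = j \<and> t = t'"
proof -
  obtain m :: int where m: "real i + t = real j + t' + real N * of_int m"
    using eq torus_eq_iff[OF assms(1)] by blast
  have "t - t' = of_int (int j - int i + int N * m)" using m by simp
  then have z: "int j - int i + int N * m = 0" using assms(4) int_in_unit_interval_diff by blast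
  then have "int N * m = int i - int j" by simp
  then have "int N * \<bar>m\<bar> = \<bar>int i - int j\<bar>" by (metis abs_mult abs_of_nat)
  also have "\<dots> < int N" using assms(2,3) by linarith
  finally have "\<not> 1 \<le> \<bar>m\<bar>" using mult_left_mono[of 1 "\<bar>m\<bar>" "int N"] by linarith
  then have "m = 0" by simp
  then show ?thesis using z m by simp
qed

text \<open>The vertices are the images of \<open>(i, 0)\<close>, the edges those of the horizontal and vertical unit segments
  that start there, for \<open>i < N\<close>.\<close>

lemma is_graph_necklace:
  assumes N: "N > 0"
  shows "is_graph (top_of_set (necklace N))"
proof -
  define V where "V = (\<lambda>i. torus N (real i, 0)) ` {..<N}"
  define E where "E = arc_edge N ` {..<N} \<union> bead_edge N ` {..<N}"
  have vertex: "torus N (real k, 0) \<in> V" for k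
  proof -
    obtain i :: nat and r :: real where "i < N" "0 \<le> r" "r < 1" "real k \<in> \<int> \<longrightarrow> r = 0"
      and "\<forall>u. torus N (real k, u) = torus N (real i + r, u)"
      using torus_reduce[OF N, of "real k"] by blast
    then have "i < N" "torus N (real k, 0) = torus N (real i, 0)" by simp_all
    then show ?thesis unfolding V_def by blast
  qed
  have turn: "torus N (a, 1) = torus N (a, 0)" for a by (simp add: torus_def)
  have in_necklace: "torus N (a, 0) \<in> necklace N" "torus N (real k, a) \<in> necklace N" for a k
    by (auto simp: necklace_def grid_def)
  have cont: "continuous_on A (arc_edge N i)" "continuous_on A (bead_edge N i)" for A i
    unfolding arc_edge_def bead_edge_def
    by (rule continuous_on_compose2[OF continuous_torus[of UNIV]]; auto intro!: continuous_intros)+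
  have frac0: "of_int n \<noteq> t" if "t \<in> {0<..<1}" for n :: int and t :: real
    using that int_in_unit_interval_diff[of t 0 n] by auto
  have arc_vs_bead: "torus N (a, 0) \<noteq> torus N (b, t)" if "t \<in> {0<..<1}" for a b t
  proof
    assume "torus N (a, 0) = torus N (b, t)"
    then obtain n :: int where "0 = t + of_int n" using torus_eq_iff[OF N] by blast
    then show False using frac0[OF that, of "- n"] by simp
  qed
  have arc_vs_vertex: "torus N (real i + t, 0) \<noteq> torus N (real j, 0)"
    if "t \<in> {0<..<1}" "i < N" "j < N" for i j t
    using torus_eq_in_cell[OF N that(2,3), of t 0] that(1) by auto
  have bead_eq: "i = j \<and> t = t'" if "torus N (real i, t) = torus N (real j, t')" "i < N" "j < N"
    "t \<in> {0<..<1}" "t' \<in> {0<..<1}" for i j t t'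
  proof -
    from that(1) obtain n :: int where n: "t = t' + of_int n"
      unfolding torus_eq_iff[OF N] by blast
    moreover have "\<bar>t - t'\<bar> < 1" using that(4,5) by (simp add: abs_less_iff)
    ultimately have "n = 0" using int_in_unit_interval_diff[of t t' n] by simp
    with n have "t = t'" by simp
    moreover have "i = j" using torus_eq_in_cell[OF N that(2,3), of 0 0 t t'] that(1)
      unfolding add_0_right by simp
    ultimately show ?thesis by simp
  qed
  have "graph_structure (top_of_set (necklace N)) V E"
  proof (rule finite_graph_structureI)
    show "Hausdorff_space (top_of_set (necklace N))" by (simp add: Hausdorff_space_subtopology)
    show "finite E" by (simp add: E_def)
    show "E \<noteq> {}" using N by (auto simp: E_def)
    show "pathin (top_of_set (necklace N)) e" if "e \<in> E" for e
    proof -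
      have "arc_edge N i t \<in> necklace N" "bead_edge N i t \<in> necklace N" for i t
        by (simp_all add: arc_edge_def bead_edge_def in_necklace)
      then show ?thesis using that cont by (auto simp: E_def pathin_def continuous_map_in_subtopology)
    qed
    show "e 0 \<in> V \<and> e 1 \<in> V" if "e \<in> E" for e
    proof -
      have "torus N (real i + 1, 0) \<in> V" for i using vertex[of "Suc i"] by (simp add: add.commute)
      then show ?thesis using that vertex by (auto simp: E_def arc_edge_def bead_edge_def turn)
    qed
    show "inj_on e {0<..<1}" if "e \<in> E" for e
      using that unfolding E_def
    proof (elim UnE imageE)
      fix i assume "e = arc_edge N i" "i \<in> {..<N}"
      then show ?thesis
        using torus_eq_in_cell[OF N, of i i _ _ 0 0] by (intro inj_onI) (auto simp: arc_edge_def)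
    next
      fix i assume "e = bead_edge N i" "i \<in> {..<N}"
      then show ?thesis
        using bead_eq[of i _ i] by (intro inj_onI) (auto simp: bead_edge_def)
    qed
    show "disjnt (e ` {0<..<1}) V" if "e \<in> E" for e
      using that unfolding E_def
    proof (elim UnE imageE)
      fix i assume "e = arc_edge N i" "i \<in> {..<N}"
      then show ?thesis using arc_vs_vertex by (auto simp: V_def arc_edge_def disjnt_iff)
    next
      fix i assume e: "e = bead_edge N i"
      have "bead_edge N i t \<noteq> torus N (real j, 0)" if "t \<in> {0<..<1}" for t j
        using arc_vs_bead[OF that, of "real j" "real i"] by (simp add: bead_edge_def)
      then show ?thesis by (auto simp: V_def e disjnt_iff)
    qed
    show "pairwise (\<lambda>e e'. disjnt (e ` {0<..<1}) (e' ` {0<..<1})) E"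
      unfolding pairwise_def disjnt_iff
    proof (intro ballI impI allI notI)
      fix e e' p assume e: "e \<in> E" "e' \<in> E" "e \<noteq> e'" and "p \<in> e ` {0<..<1} \<and> p \<in> e' ` {0<..<1}"
      then obtain t t' where t: "t \<in> {0<..<1}" "t' \<in> {0<..<1}" "e t = e' t'" by auto
      from e(1,2) show False
        unfolding E_def
      proof (elim UnE imageE)
        fix i j assume "e = arc_edge N i" "e' = arc_edge N j" "i \<in> {..<N}" "j \<in> {..<N}"
        then show False using t e(3) torus_eq_in_cell[OF N, of i j t t' 0 0] by (auto simp: arc_edge_def)
      next
        fix i j assume "e = arc_edge N i" "e' = bead_edge N j"
        then show False using t(3) arc_vs_bead[OF t(2), of "real i + t" "real j"] by (simp add: arc_edge_def bead_edge_def)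
      next
        fix i j assume "e = bead_edge N i" "e' = arc_edge N j"
        then show False using t(3) arc_vs_bead[OF t(1), of "real j + t'" "real i"] by (simp add: arc_edge_def bead_edge_def)
      next
        fix i j assume "e = bead_edge N i" "e' = bead_edge N j" "i \<in> {..<N}" "j \<in> {..<N}"
        then show False using t e(3) bead_eq[of i t j t'] by (auto simp: bead_edge_def)
      qed
    qed
    show "V \<subseteq> (\<Union>e\<in>E. e ` {0..1})"
    proof
      fix v assume "v \<in> V"
      then obtain i where "i < N" "v = arc_edge N i 0" by (auto simp: V_def arc_edge_def)
      then show "v \<in> (\<Union>e\<in>E. e ` {0..1})" by (intro UN_I[of "arc_edge N i"]) (auto simp: E_def)
    qed
    show "topspace (top_of_set (necklace N)) = V \<union> (\<Union>e\<in>E. e ` {0<..<1})"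
    proof (intro equalityI subsetI)
      fix p assume "p \<in> topspace (top_of_set (necklace N))"
      then obtain s u where p: "p = torus N (s, u)" "s \<in> \<int> \<or> u \<in> \<int>" by (auto simp: necklace_def grid_def)
      obtain i :: nat and r :: real where i: "i < N" "0 \<le> r" "r < 1" "s \<in> \<int> \<longrightarrow> r = 0"
        "\<forall>u. torus N (s, u) = torus N (real i + r, u)"
      using torus_reduce[OF N, of s] by blast
      have p': "p = torus N (real i + r, frac u)"
      using p(1) i(5)[rule_format, of "frac u"] torus_reduce_meridian[OF N, of s u] by simp
      have "r = 0 \<or> frac u = 0" using p(2) i(4) by auto
      then consider "r = 0" "frac u = 0" | "r > 0" "frac u = 0" | "r = 0" "frac u > 0"
        using i(2) frac_ge_0[of u] by linarith
      then show "p \<in> V \<union> (\<Union>e\<in>E. e ` {0<..<1})"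
      proof cases
        case 1
        have "p = torus N (real i, 0)" using p' unfolding 1 by simp
        then show ?thesis using i(1) by (auto simp: V_def)
      next
        case 2
        have "p = arc_edge N i r" using p' unfolding 2(2) by (simp add: arc_edge_def)
        moreover have "r \<in> {0<..<1}" using 2 i(3) by simp
        moreover have "arc_edge N i \<in> E" using i(1) by (simp add: E_def)
        ultimately show ?thesis by blast
      next
        case 3
        then have "p = bead_edge N i (frac u)" "frac u \<in> {0<..<1}"
          using p' by (auto simp: bead_edge_def frac_lt_1)
        moreover have "bead_edge N i \<in> E" using i(1) by (simp add: E_def)
        ultimately show ?thesis by blast
      qed
    next
      fix p assume "p \<in> V \<union> (\<Union>e\<in>E. e ` {0<..<1})"
      then show "p \<in> topspace (top_of_set (necklace N))"
        using in_necklace by (auto simp: E_def V_def arc_edge_def bead_edge_def)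
    qed
  qed
  then show ?thesis
    unfolding is_graph_def by (auto simp: Hausdorff_space_subtopology)
qed

section \<open>The loop around the necklace\<close>

definition ramp :: "real \<Rightarrow> real \<Rightarrow> real" where
  "ramp a y = max 0 (min 1 (y - a))"

text \<open>The curve in the plane grid, at speed one grid edge per unit of time. Lap \<open>k\<close> takes the time from
  \<open>5 k\<close> to \<open>5 k + 5\<close> and goes right, up, left, down, right; each \<open>ramp\<close> is one of these moves. Writing
  the curve as a sum of ramps makes its continuity evident.\<close>

definition route :: "nat \<Rightarrow> real \<Rightarrow> real \<times> real" where
  "route N y =
     ((\<Sum>k<N. ramp (5 * real k) y - ramp (5 * real k + 2) y + ramp (5 * real k + 4) y),
      (\<Sum>k<N. ramp (5 * real k + 1) y - ramp (5 * real k + 3) y))"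

definition necklace_loop :: "nat \<Rightarrow> real \<Rightarrow> real^3" where
  "necklace_loop N t = torus N (route N (5 * real N * t))"

text \<open>The earlier laps have been completed and contribute \<open>1\<close> and \<open>0\<close> to the two coordinates; the later
  ones have not begun and contribute nothing.\<close>

lemma route_stage:
  fixes k N :: nat and z :: real
  assumes "k < N" "0 \<le> z" "z \<le> 5"
  shows "route N (5 * real k + z) = (real k + ramp 0 z - ramp 2 z + ramp 4 z, ramp 1 z - ramp 3 z)"
proof -
  have *: "(\<Sum>i<N. f i) = real k * c + f k"
    if "\<And>i. i < k \<Longrightarrow> f i = c" "\<And>i. k < i \<Longrightarrow> f i = 0" for f :: "nat \<Rightarrow> real" and c :: real
  proof -
    have "(\<Sum>i<N. f i) = (\<Sum>i<N. (if i < k then c else 0) + (if i = k then f k else 0))"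
      using that by (intro sum.cong) (auto simp: not_less le_less)
    also have "\<dots> = (\<Sum>i | i < N \<and> i < k. c) + f k"
      using assms(1) by (simp add: sum.distrib flip: sum.inter_filter)
    also have "{i. i < N \<and> i < k} = {..<k}" using assms(1) by auto
    finally show ?thesis by simp
  qed
  have before: "ramp (5 * real i + a) (5 * real k + z) = 1" if "i < k" "a \<le> 4" for i :: nat and a
  proof -
    have "real i + 1 \<le> real k" using that(1) by linarith
    then show ?thesis using that(2) assms(2) by (simp add: ramp_def)
  qed
  have after: "ramp (5 * real i + a) (5 * real k + z) = 0" if "k < i" "0 \<le> a" for i :: nat and a
  proof -
    have "real k + 1 \<le> real i" using that(1) by linarith
    then show ?thesis using that(2) assms(3) by (simp add: ramp_def)
  qed
  have "(\<Sum>i<N. ramp (5 * real i) (5 * real k + z) - ramp (5 * real i + 2) (5 * real k + z) + ramp (5 * real i + 4) (5 * real k + z))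
      = real k * 1 + (ramp (5 * real k) (5 * real k + z) - ramp (5 * real k + 2) (5 * real k + z) + ramp (5 * real k + 4) (5 * real k + z))"
    using before[of _ 0] after[of _ 0] by (intro *) (auto simp: before after)
  moreover have "(\<Sum>i<N. ramp (5 * real i + 1) (5 * real k + z) - ramp (5 * real i + 3) (5 * real k + z))
      = real k * 0 + (ramp (5 * real k + 1) (5 * real k + z) - ramp (5 * real k + 3) (5 * real k + z))"
    by (intro *) (auto simp: before after)
  ultimately show ?thesis by (simp add: route_def ramp_def)
qed

lemma route_pieces:
  fixes k N :: nat and r :: real
  assumes "k < N" "0 \<le> r" "r \<le> 1"
  shows "route N (5 * real k + r) = (real k + r, 0)" "route N (5 * real k + 1 + r) = (real k + 1, r)"
    "route N (5 * real k + 2 + r) = (real k + 1 - r, 1)" "route N (5 * real k + 3 + r) = (real k, 1 - r)"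
    "route N (5 * real k + 4 + r) = (real k + r, 0)"
  using assms route_stage[of k N r] route_stage[of k N "1 + r"] route_stage[of k N "2 + r"]
    route_stage[of k N "3 + r"] route_stage[of k N "4 + r"]
  by (simp_all add: ramp_def add.assoc)

text \<open>Time \<open>y\<close> falls into move \<open>j\<close> of lap \<open>k\<close>. The final time \<open>5 N\<close> counts as the end of the last lap.\<close>

lemma route_piece_cases:
  fixes y :: real
  assumes "N > 0" "0 \<le> y" "y \<le> 5 * real N"
  obtains k :: nat and r j :: real where "k < N" "0 \<le> r" "r \<le> 1" "j \<in> {0,1,2,3,4}" "y = 5 * real k + j + r"
proof -
  define k where "k = (if y = 5 * real N then N - 1 else nat \<lfloor>y / 5\<rfloor>)"
  have k: "k < N" "5 * real k \<le> y" "y \<le> 5 * real k + 5"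
  proof -
    have "k < N \<and> 5 * real k \<le> y \<and> y \<le> 5 * real k + 5"
    proof (cases "y = 5 * real N")
      case True
      then show ?thesis using assms(1) by (simp add: k_def of_nat_diff)
    next
      case False
      then have "k = nat \<lfloor>y / 5\<rfloor>" "y < 5 * real N" using assms by (auto simp: k_def)
      moreover have "of_int \<lfloor>y / 5\<rfloor> \<le> y / 5" "y / 5 < of_int \<lfloor>y / 5\<rfloor> + 1" "0 \<le> \<lfloor>y / 5\<rfloor>"
        using assms(2) by linarith+
      ultimately have "real k \<le> y / 5" "y / 5 < real k + 1" by simp_all
      with \<open>y < 5 * real N\<close> show ?thesis by simp
    qed
    then show "k < N" "5 * real k \<le> y" "y \<le> 5 * real k + 5" by auto
  qed
  define z where "z = y - 5 * real k"
  have z: "0 \<le> z" "z \<le> 5" using k by (auto simp: z_def)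
  define j where "j = (if z \<le> 1 then 0 else if z \<le> 2 then 1 else if z \<le> 3 then 2 else if z \<le> 4 then 3 else 4 :: real)"
  show thesis
    by (rule that[of k "z - j" j]) (use k(1) z in \<open>auto simp: j_def z_def\<close>)
qed

text \<open>The second claim says that the curve stays within one grid edge of uniform motion along the
  longitude; it is what makes fibres small.\<close>

lemma route_in_grid:
  assumes "N > 0" "0 \<le> y" "y \<le> 5 * real N"
  shows "route N y \<in> grid" "\<bar>5 * fst (route N y) - y\<bar> \<le> 5"
proof -
  obtain k r j where k: "k < N" "0 \<le> r" "r \<le> 1" "j \<in> {0,1,2,3,4}" "y = 5 * real k + j + r"
    using route_piece_cases[OF assms] .
  then show "route N y \<in> grid" "\<bar>5 * fst (route N y) - y\<bar> \<le> 5"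
    using route_pieces[OF k(1-3)] by (auto simp: grid_def)
qed

lemma route_lap:
  fixes k N :: nat
  assumes "k \<le> N"
  shows "route N (5 * real k) = (real k, 0)"
proof (cases "k < N")
  case True
  then show ?thesis using route_pieces(1)[of k N 0] by simp
next
  case False
  show ?thesis
  proof (cases k)
    case 0
    then show ?thesis using assms False by (simp add: route_def)
  next
    case (Suc i)
    with assms False have "i < N" "real k = real i + 1" "5 * real k = 5 * real i + 4 + 1" by auto
    then show ?thesis using route_pieces(5)[of i N 1] by simp
  qed
qed

lemma continuous_route: "continuous_on A (route N)"
  unfolding route_def ramp_def by (intro continuous_intros)

lemma path_necklace_loop: "path (necklace_loop N)"
  unfolding path_def necklace_loop_def
  by (rule continuous_on_compose2[OF continuous_torus[of UNIV]])
    (auto intro!: continuous_intros continuous_on_compose2[OF continuous_route[of UNIV]])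

lemma path_image_necklace_loop:
  assumes "N > 0"
  shows "path_image (necklace_loop N) \<subseteq> necklace N"
  using route_in_grid(1)[OF assms] assms
  by (auto simp: path_image_def necklace_loop_def necklace_def mult_left_le)

text \<open>Horizontal edges are covered by the first move of a lap, vertical ones by the fourth. The second
  move would not do for the vertical edge at \<open>i = 0\<close>, which it only reaches as the edge at \<open>N\<close>.\<close>

lemma necklace_loop_surj:
  assumes N: "N > 0"
  shows "necklace_loop N ` {0..1} = necklace N"
proof
  show "necklace_loop N ` {0..1} \<subseteq> necklace N"
    using path_image_necklace_loop[OF N] by (simp add: path_image_def)
  have visit: "torus N (route N y) \<in> necklace_loop N ` {0..1}" if "0 \<le> y" "y \<le> 5 * real N" for y
    using that N by (intro image_eqI[of _ _ "y / (5 * real N)"]) (auto simp: necklace_loop_def)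
  show "necklace N \<subseteq> necklace_loop N ` {0..1}"
  proof
    fix p assume "p \<in> necklace N"
    then obtain s u where p: "p = torus N (s, u)" "s \<in> \<int> \<or> u \<in> \<int>" by (auto simp: necklace_def grid_def)
    obtain i :: nat and r :: real where i: "i < N" "0 \<le> r" "r < 1" "s \<in> \<int> \<longrightarrow> r = 0"
      "\<forall>u. torus N (s, u) = torus N (real i + r, u)"
      using torus_reduce[OF N, of s] by blast
    have p': "p = torus N (real i + r, frac u)"
      using p(1) i(5)[rule_format, of "frac u"] torus_reduce_meridian[OF N, of s u] by simp
    have iN: "real i + 1 \<le> real N" using i(1) by linarith
    show "p \<in> necklace_loop N ` {0..1}"
    proof (cases "u \<in> \<int>")
      case True
      then have "p = torus N (route N (5 * real i + r))"
        using p' route_pieces(1)[OF i(1,2)] i(3) by (simp add: frac_eq_0_iff[THEN iffD2])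
      then show ?thesis using visit[of "5 * real i + r"] i(2,3) iN by simp
    next
      case False
      then have "r = 0" using p(2) i(4) by blast
      have f: "0 \<le> 1 - frac u" "1 - frac u \<le> 1" using frac_lt_1[of u] by auto
      then have "p = torus N (route N (5 * real i + 3 + (1 - frac u)))"
        using p' route_pieces(4)[OF i(1) f] \<open>r = 0\<close> by simp
      then show ?thesis using visit[of "5 * real i + 3 + (1 - frac u)"] f iN by simp
    qed
  qed
qed

lemma necklace_loop_fibre:
  assumes N: "N > 0" and t: "t \<in> {0..1}" "t' \<in> {0..1}"
    and eq: "necklace_loop N t = necklace_loop N t'"
  obtains m :: int where "\<bar>t - t' - of_int m\<bar> \<le> 2 / real N"
proof -
  define y y' where "y = 5 * real N * t" and "y' = 5 * real N * t'"
  have y: "0 \<le> y" "y \<le> 5 * real N" "0 \<le> y'" "y' \<le> 5 * real N"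
    using t by (auto simp: y_def y'_def mult_left_le)
  obtain s u s' u' where r: "route N y = (s, u)" "route N y' = (s', u')" by fastforce
  have "torus N (s, u) = torus N (s', u')" using eq r by (simp add: necklace_loop_def y_def y'_def)
  then obtain m :: int where m: "s = s' + real N * of_int m" using torus_eq_iff[OF N] by blast
  have "\<bar>5 * s - y\<bar> \<le> 5" "\<bar>5 * s' - y'\<bar> \<le> 5"
    using route_in_grid(2)[OF N y(1,2)] route_in_grid(2)[OF N y(3,4)] r by simp_all
  then have "\<bar>(y - y') / 5 - c\<bar> \<le> 2" if "s = s' + c" for c using that by argo
  from this[OF m] have "\<bar>(y - y') / 5 - real N * of_int m\<bar> \<le> 2" .
  moreover have "(y - y') / 5 - real N * of_int m = real N * (t - t' - of_int m)"
    by (simp add: y_def y'_def diff_divide_distrib algebra_simps)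
  ultimately have "real N * \<bar>t - t' - of_int m\<bar> \<le> 2" by (simp add: abs_mult)
  then show thesis using N by (intro that[of m]) (simp add: field_simps)
qed

section \<open>The homotopy class of the loop\<close>

text \<open>The stem to \<open>(k, 0)\<close> is kept as a path in the plane, also for \<open>k \<ge> N\<close>: the stem to \<open>(N, 0)\<close> is the full
  longitude, although it ends where the stem to \<open>(0, 0)\<close> does.\<close>

definition stem :: "nat \<Rightarrow> nat \<Rightarrow> real \<Rightarrow> real^3" where
  "stem N k = torus N \<circ> linepath (0, 0) (real k, 0)"

definition bead :: "nat \<Rightarrow> nat \<Rightarrow> real \<Rightarrow> real^3" where
  "bead N k = torus N \<circ> linepath (real k, 0) (real k, 1)"

lemma linepath_Pair: "linepath (a, b) (c, d) t = (linepath a c t, linepath b d t)"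
  by (simp add: linepath_def)

lemma linepath_0_1: "linepath 0 1 t = (t :: real)"
  by (simp add: linepath_def)

lemma path_image_linepath_row: "path_image (linepath (a, 0) (b, 0)) \<subseteq> UNIV \<times> {0 :: real}"
  for a b :: real
  by (auto simp: path_image_def linepath_Pair linepath_refl)

lemma row_subset_grid: "UNIV \<times> {0} \<subseteq> grid"
  by (auto simp: grid_def)

lemma path_from_to_torus:
  assumes "path g" "path_image g \<subseteq> grid"
  shows "path_from_to (necklace N) (torus N (pathstart g)) (torus N (pathfinish g)) (torus N \<circ> g)"
  using assms
  by (auto simp: path_from_to_def pathstart_compose pathfinish_compose path_image_compose necklace_def
      intro!: path_continuous_image continuous_torus)

lemma path_from_to_stem: "path_from_to (necklace N) (torus N (0, 0)) (torus N (real k, 0)) (stem N k)"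
  using path_from_to_torus[OF _ order.trans[OF path_image_linepath_row row_subset_grid], of 0 "real k" N]
  by (simp add: stem_def)

lemma path_from_to_bead: "path_from_to (necklace N) (torus N (real k, 0)) (torus N (real k, 0)) (bead N k)"
proof -
  have "torus N (real k, 1) = torus N (real k, 0)" by (simp add: torus_def)
  moreover have "path_image (linepath (real k, 0) (real k, 1)) \<subseteq> grid"
    by (auto simp: path_image_def linepath_Pair linepath_refl grid_def)
  ultimately show ?thesis
    using path_from_to_torus[of "linepath (real k, 0) (real k, 1)" N] by (simp add: bead_def)
qed

definition tethered_class :: "nat \<Rightarrow> nat \<Rightarrow> (real \<Rightarrow> real^3) \<Rightarrow> nat \<Rightarrow> (real \<Rightarrow> real^3) set" where
  "tethered_class N i r j =
     loop_class (top_of_set (necklace N)) (torus N (0, 0)) (tether (stem N i) r (stem N j))"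

abbreviation necklace_group :: "nat \<Rightarrow> (real \<Rightarrow> real^3) set monoid" where
  "necklace_group N \<equiv> fundamental_group (top_of_set (necklace N)) (torus N (0, 0))"

abbreviation vertex_path :: "nat \<Rightarrow> nat \<Rightarrow> (real \<Rightarrow> real^3) \<Rightarrow> nat \<Rightarrow> bool" where
  "vertex_path N i r j \<equiv> path_from_to (necklace N) (torus N (real i, 0)) (torus N (real j, 0)) r"

lemma tethered_class_carrier:
  "vertex_path N i r j \<Longrightarrow> tethered_class N i r j \<in> carrier (necklace_group N)"
  unfolding tethered_class_def carrier_fundamental_group
  using loop_at_tether[OF path_from_to_stem _ path_from_to_stem] by blast

lemma tethered_class_join:
  assumes "vertex_path N i r j" "vertex_path N j r' k"
  shows "tethered_class N i r j \<otimes>\<^bsub>necklace_group N\<^esub> tethered_class N j r' k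
    = tethered_class N i (r +++ r') k"
  unfolding tethered_class_def
  by (rule tether_join[OF path_from_to_stem path_from_to_stem path_from_to_stem assms])

lemma tethered_class_cong:
  assumes "vertex_path N i r j" "homotopic_paths (necklace N) r r'"
  shows "tethered_class N i r j = tethered_class N i r' j"
  unfolding tethered_class_def
  by (rule tether_cong[OF path_from_to_stem assms(1) path_from_to_stem assms(2)])

lemma tethered_class_cong_pointwise:
  assumes "vertex_path N i r j" "\<And>t. t \<in> {0..1} \<Longrightarrow> r t = r' t"
  shows "tethered_class N i r j = tethered_class N i r' j"
  using assms by (intro tethered_class_cong homotopic_paths_eq) (auto simp: path_from_to_def)

text \<open>Stems and \<open>g\<close> all come from the line \<open>u = 0\<close> of the plane, which is simply connected.\<close>

lemma tethered_class_row:
  assumes g: "path g" "path_image g \<subseteq> UNIV \<times> {0}" "pathstart g = (real i, 0)" "pathfinish g = (real j, 0)"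
  shows "tethered_class N i (torus N \<circ> g) j = \<one>\<^bsub>necklace_group N\<^esub>"
proof -
  let ?l = "\<lambda>k::nat. linepath (0, 0) (real k, 0 :: real)"
  let ?row = "UNIV \<times> {0} :: (real \<times> real) set"
  let ?q = "tether (?l i) g (?l j)"
  note row = path_image_linepath_row
  have "path_image ?q \<subseteq> ?row"
    unfolding tether_def path_image_reversepath
    by (intro subset_path_image_join) (simp_all add: row g(2) del: path_image_linepath)
  then have q: "path ?q" "path_image ?q \<subseteq> ?row" "pathstart ?q = (0, 0)" "pathfinish ?q = (0, 0)"
    unfolding tether_def using g by simp_all
  have "simply_connected ?row" by (intro convex_imp_simply_connected convex_Times) auto
  then have "homotopic_paths ?row ?q (linepath (0, 0) (0, 0))"
    using q row[of 0 0] unfolding simply_connected_eq_homotopic_paths by simp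
  then have "homotopic_paths (necklace N) (torus N \<circ> ?q) (torus N \<circ> linepath (0, 0) (0, 0))"
    by (rule homotopic_paths_continuous_image)
      (auto intro!: continuous_torus simp: necklace_def grid_def)
  moreover have "torus N \<circ> ?q = tether (stem N i) (torus N \<circ> g) (stem N j)"
    by (simp add: tether_def stem_def path_compose_join path_compose_reversepath del: reversepath_linepath)
  moreover have "torus N \<circ> linepath (0, 0) (0, 0) = (\<lambda>_. torus N (0, 0))"
    by (auto simp: linepath_refl)
  ultimately have hom: "homotopic_paths (necklace N) (tether (stem N i) (torus N \<circ> g) (stem N j)) (\<lambda>_. torus N (0, 0))"
    by simp
  have loops: "loop_at (top_of_set (necklace N)) (torus N (0, 0)) (\<lambda>_. torus N (0, 0))"
    by (rule loop_at_const) (auto simp: necklace_def grid_def)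
  have "homotopic_paths (necklace N) (\<lambda>_. torus N (0, 0)) (tether (stem N i) (torus N \<circ> g) (stem N j))"
    using hom by (rule homotopic_paths_sym)
  with loops have "loop_at (top_of_set (necklace N)) (torus N (0, 0)) (tether (stem N i) (torus N \<circ> g) (stem N j))"
    by (rule loop_at_homotopic)
  with loops hom show ?thesis by (simp add: tethered_class_def one_fundamental_group loop_class_eq_iff)
qed

lemma tethered_class_rest:
  "tethered_class N k (\<lambda>_. torus N (real k, 0)) k = \<one>\<^bsub>necklace_group N\<^esub>"
proof -
  have "tethered_class N k (torus N \<circ> linepath (real k, 0) (real k, 0)) k = \<one>\<^bsub>necklace_group N\<^esub>"
    by (rule tethered_class_row[OF _ path_image_linepath_row]) simp_all
  then show ?thesis by (simp add: o_def linepath_refl)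
qed

lemma tethered_class_reversepath:
  assumes "vertex_path N i r j"
  shows "tethered_class N j (reversepath r) i = inv\<^bsub>necklace_group N\<^esub> tethered_class N i r j"
proof -
  interpret group "necklace_group N"
    by (rule group_fundamental_group) (auto simp: necklace_def grid_def)
  have rev: "vertex_path N j (reversepath r) i" using assms by (rule path_from_to_reversepath)
  have "homotopic_paths (necklace N) (reversepath r +++ r) (\<lambda>_. torus N (real j, 0))"
    using assms homotopic_paths_linv[of r "necklace N"] by (simp add: path_from_to_def linepath_refl)
  with tethered_class_cong[OF path_from_to_join[OF rev assms]]
  have "tethered_class N j (reversepath r) i \<otimes>\<^bsub>necklace_group N\<^esub> tethered_class N i r j = \<one>\<^bsub>necklace_group N\<^esub>"
    by (simp add: tethered_class_join[OF rev assms] tethered_class_rest)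
  then show ?thesis
    using tethered_class_carrier[OF rev] tethered_class_carrier[OF assms] by (simp add: inv_equality)
qed

text \<open>The part of the loop between the times \<open>a\<close> and \<open>b\<close>, where the whole loop takes the time \<open>5 N\<close>.\<close>

definition leg :: "nat \<Rightarrow> real \<Rightarrow> real \<Rightarrow> real \<Rightarrow> real^3" where
  "leg N a b = subpath (a / (5 * real N)) (b / (5 * real N)) (necklace_loop N)"

lemma leg_eq:
  assumes "N > 0"
  shows "leg N a b t = torus N (route N (linepath a b t))"
proof -
  have "5 * real N * ((b / (5 * real N) - a / (5 * real N)) * t + a / (5 * real N)) = (b - a) * t + a"
    using assms by (simp add: field_simps)
  also have "\<dots> = linepath a b t" by (simp add: linepath_def algebra_simps)
  finally show ?thesis by (simp only: leg_def subpath_def necklace_loop_def)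
qed

lemma path_from_to_leg:
  assumes "N > 0" "0 \<le> a" "a \<le> 5 * real N" "0 \<le> b" "b \<le> 5 * real N"
  shows "path_from_to (necklace N) (torus N (route N a)) (torus N (route N b)) (leg N a b)"
proof -
  have *: "a / (5 * real N) \<in> {0..1}" "b / (5 * real N) \<in> {0..1}" using assms by auto
  have "path_image (leg N a b) \<subseteq> path_image (necklace_loop N)"
    unfolding leg_def using * by (rule path_image_subpath_subset)
  moreover have "path (leg N a b)" unfolding leg_def using path_necklace_loop * by (intro path_subpath)
  ultimately show ?thesis
    using path_image_necklace_loop[OF assms(1)] assms(1)
    by (auto simp: path_from_to_def pathstart_def pathfinish_def leg_eq linepath_def)
qed

lemma tethered_class_leg_join:
  assumes "N > 0" "0 \<le> a" "a \<le> 5 * real N" "0 \<le> b" "b \<le> 5 * real N" "0 \<le> c" "c \<le> 5 * real N"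
    and ends: "torus N (route N a) = torus N (real i, 0)" "torus N (route N b) = torus N (real j, 0)"
      "torus N (route N c) = torus N (real k, 0)"
  shows "tethered_class N i (leg N a c) k
    = tethered_class N i (leg N a b) j \<otimes>\<^bsub>necklace_group N\<^esub> tethered_class N j (leg N b c) k"
proof -
  have ab: "vertex_path N i (leg N a b) j" and bc: "vertex_path N j (leg N b c) k"
    using path_from_to_leg assms by metis+
  have "homotopic_paths (necklace N) (leg N a b +++ leg N b c) (leg N a c)"
    unfolding leg_def using assms path_necklace_loop path_image_necklace_loop
    by (intro homotopic_join_subpaths) auto
  from tethered_class_cong[OF path_from_to_join[OF ab bc] this] show ?thesis
    by (simp add: tethered_class_join[OF ab bc])
qed

text \<open>Of the five moves of a lap, the three horizontal ones are trivial by \<open>tethered_class_row\<close> (at height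
  \<open>1\<close> the torus looks as at height \<open>0\<close>). The way up is the meridian at \<open>k + 1\<close>, the way down the reversed
  meridian at \<open>k\<close>.\<close>

lemma tethered_class_lap:
  assumes "k < N"
  defines "G \<equiv> necklace_group N"
  shows "tethered_class N 0 (leg N 0 (5 * real (Suc k))) (Suc k) =
    tethered_class N 0 (leg N 0 (5 * real k)) k \<otimes>\<^bsub>G\<^esub>
    tethered_class N (Suc k) (bead N (Suc k)) (Suc k) \<otimes>\<^bsub>G\<^esub> inv\<^bsub>G\<^esub> tethered_class N k (bead N k) k"
proof -
  interpret group G
    unfolding G_def by (rule group_fundamental_group) (auto simp: necklace_def grid_def)
  have N: "N > 0" "real k + 1 \<le> real N" using assms by auto
  define y where "y j = 5 * real k + j" for j :: real
  have y: "0 \<le> y j" "y j \<le> 5 * real N" if "0 \<le> j" "j \<le> 5" for j using that N by (auto simp: y_def)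
  note pieces = route_pieces[OF assms(1)]
  have turn: "torus N (a, 1) = torus N (a, 0)" for a by (simp add: torus_def)
  have at: "torus N (route N 0) = torus N (real 0, 0)" "torus N (route N (y 0)) = torus N (real k, 0)"
    "torus N (route N (y 1)) = torus N (real (Suc k), 0)" "torus N (route N (y 2)) = torus N (real (Suc k), 0)"
    "torus N (route N (y 3)) = torus N (real k, 0)" "torus N (route N (y 4)) = torus N (real k, 0)"
    "torus N (route N (y 5)) = torus N (real (Suc k), 0)"
    using pieces(1)[of 0] pieces(1)[of 1] pieces(2)[of 1] pieces(3)[of 1] pieces(4)[of 1] pieces(5)[of 1]
      route_lap[of 0 N] by (simp_all add: y_def turn add.commute)
  have lp: "linepath a (a + 1) t = a + t" for a t :: real by (simp add: linepath_def algebra_simps)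
  have leg_piece: "leg N (y j) (y (j + 1)) t = torus N (route N (5 * real k + j + t))" for j t
    using lp[of "y j" t] by (simp add: leg_eq[OF N(1)] y_def add.assoc)
  have arcs: "vertex_path N k (leg N (y 0) (y 1)) (Suc k)" "vertex_path N (Suc k) (leg N (y 1) (y 2)) (Suc k)"
    "vertex_path N (Suc k) (leg N (y 2) (y 3)) k" "vertex_path N k (leg N (y 3) (y 4)) k" "vertex_path N k (leg N (y 4) (y 5)) (Suc k)"
    using path_from_to_leg[OF N(1), of "y 0" "y 1"] path_from_to_leg[OF N(1), of "y 1" "y 2"]
      path_from_to_leg[OF N(1), of "y 2" "y 3"] path_from_to_leg[OF N(1), of "y 3" "y 4"]
      path_from_to_leg[OF N(1), of "y 4" "y 5"] y
    by (simp_all add: at)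
  have arc0: "vertex_path N 0 (leg N 0 (y 0)) k"
    using path_from_to_leg[OF N(1), of 0 "y 0"] y N at by simp
  have forward: "tethered_class N k r (Suc k) = \<one>\<^bsub>G\<^esub>"
    if "vertex_path N k r (Suc k)" "\<And>t. t \<in> {0..1} \<Longrightarrow> r t = torus N (real k + t, 0)" for r
  proof -
    have "tethered_class N k r (Suc k) = tethered_class N k (torus N \<circ> linepath (real k, 0) (real (Suc k), 0)) (Suc k)"
      using that by (intro tethered_class_cong_pointwise) (auto simp: linepath_Pair linepath_def algebra_simps)
    also have "\<dots> = \<one>\<^bsub>G\<^esub>" unfolding G_def by (rule tethered_class_row[OF _ path_image_linepath_row]) simp_all
    finally show ?thesis .
  qed
  have s1: "tethered_class N k (leg N (y 0) (y 1)) (Suc k) = \<one>\<^bsub>G\<^esub>"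
    using leg_piece[of 0] pieces(1) by (intro forward arcs) simp
  have s2: "tethered_class N (Suc k) (leg N (y 1) (y 2)) (Suc k) = tethered_class N (Suc k) (bead N (Suc k)) (Suc k)"
    using leg_piece[of 1] pieces(2)
    by (intro tethered_class_cong_pointwise arcs) (simp add: bead_def linepath_Pair linepath_refl linepath_0_1 add.commute)
  have s3: "tethered_class N (Suc k) (leg N (y 2) (y 3)) k = \<one>\<^bsub>G\<^esub>"
  proof -
    have "tethered_class N (Suc k) (leg N (y 2) (y 3)) k
      = tethered_class N (Suc k) (torus N \<circ> linepath (real (Suc k), 0) (real k, 0)) k"
      using leg_piece[of 2] pieces(3)
      by (intro tethered_class_cong_pointwise arcs)
        (simp add: turn linepath_Pair linepath_refl linepath_def algebra_simps)
    also have "\<dots> = \<one>\<^bsub>G\<^esub>" unfolding G_def by (rule tethered_class_row[OF _ path_image_linepath_row]) simp_all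
    finally show ?thesis .
  qed
  have s4: "tethered_class N k (leg N (y 3) (y 4)) k = inv\<^bsub>G\<^esub> tethered_class N k (bead N k) k"
    unfolding G_def tethered_class_reversepath[OF path_from_to_bead, symmetric]
    using leg_piece[of 3] pieces(4)
    by (intro tethered_class_cong_pointwise arcs)
      (simp add: bead_def reversepath_def linepath_Pair linepath_refl linepath_0_1)
  have s5: "tethered_class N k (leg N (y 4) (y 5)) (Suc k) = \<one>\<^bsub>G\<^esub>"
    using leg_piece[of 4] pieces(5) by (intro forward arcs) simp
  have split: "tethered_class N 0 (leg N 0 (y b)) j
      = tethered_class N 0 (leg N 0 (y a)) i \<otimes>\<^bsub>G\<^esub> tethered_class N i (leg N (y a) (y b)) j"
    if "0 \<le> a" "a \<le> 5" "0 \<le> b" "b \<le> 5" "torus N (route N (y a)) = torus N (real i, 0)"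
      "torus N (route N (y b)) = torus N (real j, 0)" for a b i j
    unfolding G_def using that at(1) N y by (intro tethered_class_leg_join) auto
  have closed: "tethered_class N 0 (leg N 0 (y 0)) k \<in> carrier G"
    "tethered_class N k (bead N k) k \<in> carrier G"
    "tethered_class N (Suc k) (bead N (Suc k)) (Suc k) \<in> carrier G"
    unfolding G_def by (intro tethered_class_carrier arc0 path_from_to_bead)+
  have "tethered_class N 0 (leg N 0 (y 5)) (Suc k) = tethered_class N 0 (leg N 0 (y 0)) k \<otimes>\<^bsub>G\<^esub>
      \<one>\<^bsub>G\<^esub> \<otimes>\<^bsub>G\<^esub> tethered_class N (Suc k) (bead N (Suc k)) (Suc k) \<otimes>\<^bsub>G\<^esub> \<one>\<^bsub>G\<^esub> \<otimes>\<^bsub>G\<^esub>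
      inv\<^bsub>G\<^esub> tethered_class N k (bead N k) k \<otimes>\<^bsub>G\<^esub> \<one>\<^bsub>G\<^esub>"
    unfolding split[of 4 5, OF _ _ _ _ at(6,7), simplified] split[of 3 4, OF _ _ _ _ at(5,6), simplified]
      split[of 2 3, OF _ _ _ _ at(4,5), simplified] split[of 1 2, OF _ _ _ _ at(3,4), simplified]
      split[of 0 1, OF _ _ _ _ at(2,3), simplified] s1 s2 s3 s4 s5 ..
  then show ?thesis using closed by (simp add: y_def add.commute)
qed

text \<open>The element \<open>t\<close> is the class of the longitude, as a constant path reached by the stem to \<open>(N, 0)\<close> and
  left by the stem to \<open>(0, 0)\<close>. In this form, \<open>F N \<otimes> t\<close>, \<open>Y N \<otimes> t\<close> and \<open>t \<otimes> Y 0\<close> are computed by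
  \<open>tethered_class_join\<close>.\<close>

theorem necklace_loop_not_in_free_basis:
  assumes N: "N > 0" and B: "free_basis (necklace_group N) B"
  shows "loop_class (top_of_set (necklace N)) (torus N (0, 0)) (necklace_loop N) \<notin> B"
proof -
  define G where "G = necklace_group N"
  define x where "x = torus N (0, 0)"
  have x: "x \<in> necklace N" by (auto simp: x_def necklace_def grid_def)
  interpret group G unfolding G_def x_def[symmetric] by (rule group_fundamental_group[OF x])
  have meridian_unit: "norm (meridian p) = 1" if "p \<in> necklace N" for p
    using that by (auto simp: necklace_def meridian_torus)
  then have "0 \<notin> meridian ` necklace N" by force
  then obtain \<omega> where
    \<omega>: "\<And>p. loop_at (top_of_set (necklace N)) x p \<Longrightarrow>
        \<omega> (loop_class (top_of_set (necklace N)) x p) = winding_number (meridian \<circ> p) 0"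
      "\<And>a b. a \<in> carrier G \<Longrightarrow> b \<in> carrier G \<Longrightarrow> \<omega> (a \<otimes>\<^bsub>G\<^esub> b) = \<omega> a + \<omega> b"
    using winding_number_fundamental_group[OF x continuous_meridian] unfolding G_def x_def by metis
  define \<rho> where "\<rho> a = 2 powr Re (\<omega> a)" for a
  have meridian_stem: "meridian \<circ> stem N k = (\<lambda>_. 1)" for k
    by (auto simp: stem_def linepath_Pair linepath_refl meridian_torus)
  have \<omega>_tethered: "\<omega> (tethered_class N i r j) = winding_number (meridian \<circ> r) 0" if "vertex_path N i r j" for i r j
  proof -
    have "path (meridian \<circ> r)"
      using that continuous_meridian by (auto simp: path_from_to_def intro: path_continuous_image)
    moreover have "0 \<notin> path_image (meridian \<circ> r)"
      using that meridian_unit by (force simp: path_from_to_def path_image_compose)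
    moreover have "pathstart (meridian \<circ> r) = 1" "pathfinish (meridian \<circ> r) = 1"
      using that by (auto simp: path_from_to_def pathstart_compose pathfinish_compose meridian_torus)
    moreover have "meridian \<circ> tether (stem N i) r (stem N j) = tether (\<lambda>_. 1) (meridian \<circ> r) (\<lambda>_. 1)"
      by (simp add: tether_def path_compose_join path_compose_reversepath meridian_stem)
    ultimately show ?thesis
      using \<omega>(1)[unfolded x_def, OF loop_at_tether[OF path_from_to_stem that path_from_to_stem]]
      by (simp add: tethered_class_def winding_number_tether_const)
  qed
  define Y where "Y k = tethered_class N k (bead N k) k" for k
  define F where "F k = tethered_class N 0 (leg N 0 (5 * real k)) k" for k
  define t where "t = tethered_class N N (\<lambda>_. x) 0"
  have xN: "torus N (real N, u) = torus N (0, u)" for u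
    using torus_periodic[OF N, of 0 1 u 0] by simp
  have const: "vertex_path N N (\<lambda>_. x) 0"
    using x by (auto simp: path_from_to_def pathstart_def pathfinish_def path_def path_image_def xN x_def)
  have rest: "(\<lambda>_. x) = linepath x x" by (simp add: linepath_refl fun_eq_iff)
  have leg: "vertex_path N 0 (leg N 0 (5 * real N)) N"
    using path_from_to_leg[OF N, of 0 "5 * real N"] route_lap[of 0 N] route_lap[of N N] N by simp
  have FN: "F N \<otimes>\<^bsub>G\<^esub> t = loop_class (top_of_set (necklace N)) (torus N (0, 0)) (necklace_loop N)"
  proof -
    have "leg N 0 (5 * real N) = necklace_loop N" using N by (simp add: leg_def)
    with leg have loop: "vertex_path N 0 (necklace_loop N) N" by simp
    then have loop0: "vertex_path N 0 (necklace_loop N) 0" using xN[of 0] by simp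
    have "F N \<otimes>\<^bsub>G\<^esub> t = tethered_class N 0 (necklace_loop N +++ (\<lambda>_. x)) 0"
      unfolding F_def t_def G_def \<open>leg N 0 (5 * real N) = necklace_loop N\<close>
      by (rule tethered_class_join[OF loop const])
    also have "\<dots> = tethered_class N 0 (necklace_loop N) 0"
      using loop0 homotopic_paths_rid[of "necklace_loop N" "necklace N"]
      unfolding rest
      by (intro tethered_class_cong[symmetric]) (auto simp: path_from_to_def x_def homotopic_paths_sym_eq)
    also have "\<dots> = loop_class (top_of_set (necklace N)) (torus N (0, 0)) (necklace_loop N)"
    proof -
      have stem0: "stem N 0 = linepath x x" by (auto simp: stem_def x_def linepath_refl)
      have "homotopic_paths (necklace N) (linepath x x +++ (necklace_loop N +++ linepath x x)) (necklace_loop N)"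
      proof -
        have p: "path (necklace_loop N)" "path_image (necklace_loop N) \<subseteq> necklace N"
          "pathstart (necklace_loop N) = x" "pathfinish (necklace_loop N) = x"
          using loop0 by (auto simp: path_from_to_def x_def)
        have "homotopic_paths (necklace N) (linepath x x +++ (necklace_loop N +++ linepath x x)) (linepath x x +++ necklace_loop N)"
          using p x homotopic_paths_rid[OF p(1,2)] by (intro homotopic_paths_join) auto
        also have "homotopic_paths (necklace N) \<dots> (necklace_loop N)"
          using p homotopic_paths_lid[OF p(1,2)] by simp
        finally show ?thesis .
      qed
      moreover have "loop_at (top_of_set (necklace N)) x (necklace_loop N)"
        using loop0 by (auto simp: path_from_to_def x_def loop_at_iff)
      moreover have "loop_at (top_of_set (necklace N)) x (tether (stem N 0) (necklace_loop N) (stem N 0))"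
        unfolding x_def by (rule loop_at_tether[OF path_from_to_stem loop0 path_from_to_stem])
      ultimately show ?thesis
        by (simp add: tethered_class_def loop_class_eq_iff stem0 tether_def flip: x_def)
    qed
    finally show ?thesis .
  qed
  have "F N \<otimes>\<^bsub>G\<^esub> t \<notin> B"
  proof (rule telescoping_product_not_in_free_basis[where \<rho> = \<rho>])
    show "group G" ..
    show "free_basis G B" using B by (simp add: G_def)
    show "\<rho> (a \<otimes>\<^bsub>G\<^esub> b) = \<rho> a * \<rho> b" if "a \<in> carrier G" "b \<in> carrier G" for a b
      using that by (simp add: \<rho>_def \<omega> powr_add)
    show "\<rho> a \<noteq> 0" for a by (simp add: \<rho>_def)
    show "Y k \<in> carrier G" for k
      unfolding Y_def G_def by (intro tethered_class_carrier path_from_to_bead)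
    show "\<rho> (Y k) = 2" for k
    proof -
      have "meridian \<circ> bead N k = circlepath 0 1"
        by (auto simp: bead_def circlepath linepath_Pair linepath_refl linepath_0_1 meridian_torus cis_conv_exp fun_eq_iff mult_ac)
      then show ?thesis
        using \<omega>_tethered[OF path_from_to_bead] by (simp add: Y_def \<rho>_def winding_number_circlepath_centre)
    qed
    show "t \<in> carrier G" unfolding t_def G_def by (intro tethered_class_carrier const)
    show "\<rho> t = 1"
      using \<omega>_tethered[OF const]
      by (simp add: t_def \<rho>_def o_def x_def meridian_torus winding_number_zero_const)
    show "Y N \<otimes>\<^bsub>G\<^esub> t = t \<otimes>\<^bsub>G\<^esub> Y 0"
    proof -
      have "bead N N = bead N 0" by (auto simp: bead_def linepath_Pair linepath_refl xN)
      then have b: "vertex_path N N (bead N 0) N" using path_from_to_bead[of N N] by simp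
      have b': "vertex_path N N (bead N 0) 0" using b xN[of 0] by simp
      have p: "path (bead N 0)" "path_image (bead N 0) \<subseteq> necklace N" "pathstart (bead N 0) = x" "pathfinish (bead N 0) = x"
        using path_from_to_bead[of N 0] by (auto simp: path_from_to_def x_def)
      have "Y N \<otimes>\<^bsub>G\<^esub> t = tethered_class N N (bead N 0 +++ linepath x x) 0"
        unfolding Y_def t_def G_def \<open>bead N N = bead N 0\<close> rest[symmetric]
        by (rule tethered_class_join[OF b const])
      also have "\<dots> = tethered_class N N (bead N 0) 0"
        using homotopic_paths_rid[OF p(1,2)] p
        by (intro tethered_class_cong[symmetric] b') (simp add: homotopic_paths_sym_eq)
      also have "\<dots> = tethered_class N N (linepath x x +++ bead N 0) 0"
        using homotopic_paths_lid[OF p(1,2)] p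
        by (intro tethered_class_cong b') (simp add: homotopic_paths_sym_eq)
      also have "\<dots> = t \<otimes>\<^bsub>G\<^esub> Y 0"
        unfolding Y_def t_def G_def rest[symmetric]
        by (rule tethered_class_join[OF const, symmetric]) (use path_from_to_bead[of N 0] in simp)
      finally show ?thesis .
    qed
    show "F 0 = \<one>\<^bsub>G\<^esub>"
    proof -
      have "leg N 0 0 = (\<lambda>_. torus N (real 0, 0))"
        using route_lap[of 0 N] by (auto simp: leg_eq[OF N] linepath_refl)
      then show ?thesis using tethered_class_rest[of N 0] by (simp add: F_def G_def)
    qed
    show "F (Suc k) = F k \<otimes>\<^bsub>G\<^esub> Y (Suc k) \<otimes>\<^bsub>G\<^esub> inv\<^bsub>G\<^esub> Y k" if "k < N" for k
      unfolding F_def Y_def G_def by (rule tethered_class_lap[OF that])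
  qed
  then show ?thesis by (simp add: FN)
qed

section \<open>The map of the circle\<close>

text \<open>A chord is at most as long as the arc, measured modulo full turns.\<close>

lemma cmod_cis_diff_le: "cmod (cis a - cis b) \<le> \<bar>a - b - 2 * pi * of_int m\<bar>"
proof -
  define c where "c = a - b - 2 * pi * of_int m"
  have "cis (a - b) = cis c" by (simp add: c_def flip: cis_divide)
  then have "cis a - cis b = cis b * (cis c - 1)"
    by (simp add: algebra_simps flip: cis_divide) (simp add: field_simps)
  then have "cmod (cis a - cis b) = cmod (cis c - 1)" by (simp add: norm_mult)
  also have "\<dots> = 2 * \<bar>sin (c / 2)\<bar>" using dist_exp_i_1[of c] by (simp add: cis_conv_exp)
  also have "\<dots> \<le> \<bar>c\<bar>" using abs_sin_x_le_abs_x[of "c / 2"] by simp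
  finally show ?thesis by (simp add: c_def)
qed

(* A graph that is a continuous image of the circle has at most continuum many points, so
   quantifying over all topologies on sets of points of type real^3 loses no graph. *)
theorem theorem3:
  fixes \<epsilon> \<sigma> :: real and x :: complex
  assumes "\<epsilon> > 0"
    and "x \<in> sphere 0 1" and "\<sigma> \<in> {1, -1}"
  shows "\<exists>(G :: (real^3) topology) (f :: complex \<Rightarrow> real^3).
           is_graph G \<and>
           eps_map \<epsilon> G f \<and> f ` sphere 0 1 = topspace G \<and>
           \<not> (\<exists>B. free_basis (fundamental_group G (f x)) B \<and>
                  loop_class G (f x) (circle_loop x \<sigma> f) \<in> B)"
proof -
  obtain N :: nat where "4 * pi / \<epsilon> < real N" using reals_Archimedean2 by blast
  moreover from this have "real N > 0" using assms(1) pi_gt_zero by (smt (verit) divide_pos_pos)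
  ultimately have N: "N > 0" "4 * pi / real N < \<epsilon>" using assms(1) by (auto simp: field_simps)
  \<comment> \<open>The isometry \<open>w\<close> turns the circle so that the given base point and orientation become standard.\<close>
  define w where "w z = (if \<sigma> = 1 then cnj x * z else x * cnj z)" for z
  define p where "p = necklace_loop N"
  define f where "f = p \<circ> (\<lambda>z. Arg2pi z / (2 * pi)) \<circ> w"
  have x: "cmod x = 1" "x * cnj x = 1" "cnj x * x = 1"
    using assms(2) by (simp_all add: complex_norm_square[symmetric] mult.commute)
  have w_dist: "cmod (w z - w z') = cmod (z - z')" for z z'
    using x(1) by (simp add: w_def norm_mult flip: right_diff_distrib complex_cnj_diff)
  have w_sphere: "w ` sphere 0 1 = sphere 0 1"
  proof
    show "w ` sphere 0 1 \<subseteq> sphere 0 1" using x(1) by (auto simp: w_def norm_mult)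
    show "sphere 0 1 \<subseteq> w ` sphere 0 1"
    proof
      fix z :: complex assume z: "z \<in> sphere 0 1"
      have "z = w (if \<sigma> = 1 then x * z else x * cnj z)"
        using x(2,3) by (simp add: w_def flip: mult.assoc)
      then show "z \<in> w ` sphere 0 1" using z x(1) by (auto simp: norm_mult intro!: image_eqI)
    qed
  qed
  have w_cont: "continuous_on A w" for A
    unfolding w_def by (cases "\<sigma> = 1") (auto intro!: continuous_intros)
  have w_circle: "w (x * cis (\<sigma> * \<theta>)) = cis \<theta>" for \<theta>
    using assms(3) x(2,3) by (auto simp: w_def cis_cnj simp flip: mult.assoc)
  have cis_Arg: "cis (Arg2pi z) = z" if "z \<in> sphere 0 1" for z
    using that Arg2pi_eq[of z] by (simp add: cis_conv_exp)
  have Arg_range: "Arg2pi z / (2 * pi) \<in> {0..1}" for z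
    using Arg2pi[of z] by (simp add: less_imp_le)
  have Arg_cis: "Arg2pi (cis (2 * pi * t)) = 2 * pi * t" if "0 \<le> t" "t < 1" for t
    using that by (intro Arg2pi_unique[of 1]) (auto simp: cis_conv_exp)
  have p_ends: "p 0 = torus N (0, 0)" "p 1 = torus N (0, 0)"
    using route_lap[of 0 N] route_lap[of N N] torus_periodic[OF N(1), of 0 1 0 0]
    by (simp_all add: p_def necklace_loop_def)
  have p_loop: "path p" "path_image p \<subseteq> necklace N"
    using path_necklace_loop path_image_necklace_loop[OF N(1)] by (simp_all add: p_def)
  \<comment> \<open>The case \<open>t = 1\<close> is separate, since \<open>Arg2pi\<close> takes the value \<open>0\<close> there; the loop \<open>p\<close> closes up.\<close>
  have f_circle: "f (x * cis (\<sigma> * (2 * pi * t))) = p t" if "t \<in> {0..1}" for t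
  proof (cases "t = 1")
    case True
    then show ?thesis using p_ends Arg_cis[of 0] by (simp add: f_def w_circle cis_2pi)
  next
    case False
    then show ?thesis using that Arg_cis[of t] by (simp add: f_def w_circle)
  qed
  have fx: "f x = torus N (0, 0)" using f_circle[of 0] p_ends by simp
  have f_image: "f ` sphere 0 1 = necklace N"
  proof -
    have "(\<lambda>z. Arg2pi z / (2 * pi)) ` sphere 0 1 \<supseteq> {0..<1}"
    proof
      fix t :: real assume "t \<in> {0..<1}"
      then show "t \<in> (\<lambda>z. Arg2pi z / (2 * pi)) ` sphere 0 1"
        using Arg_cis[of t] by (intro image_eqI[of _ _ "cis (2 * pi * t)"]) auto
    qed
    then have "p ` {0..<1} \<subseteq> f ` sphere 0 1" "f ` sphere 0 1 \<subseteq> p ` {0..1}"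
      using Arg_range unfolding f_def image_comp[symmetric] w_sphere by (auto intro!: image_mono)
    moreover have "p ` {0..<1} = p ` {0..1}"
    proof -
      have "{0..1} = insert 1 {0..<1 :: real}" by auto
      moreover have "p 1 \<in> p ` {0..<1}" using p_ends by (intro image_eqI[of _ _ 0]) auto
      ultimately show ?thesis by auto
    qed
    ultimately show ?thesis using necklace_loop_surj[OF N(1)] by (simp add: p_def)
  qed
  \<comment> \<open>A loop, read through \<open>Arg2pi\<close>, is continuous on the circle despite the jump of \<open>Arg2pi\<close> at \<open>1\<close>.\<close>
  have "homotopic_loops (necklace N) p p"
    using p_loop p_ends by (simp add: homotopic_loops_refl pathstart_def pathfinish_def)
  then have "continuous_on (sphere 0 1) (p \<circ> (\<lambda>z. Arg2pi z / (2 * pi)))"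
    using homotopic_loops_imp_homotopic_circlemaps homotopic_with_imp_continuous by blast
  then have f_cont: "continuous_on (sphere 0 1) f"
    unfolding f_def by (intro continuous_on_compose[OF w_cont]) (simp add: w_sphere)
  have fibre: "diameter {z \<in> sphere 0 1. f z = q} < \<epsilon>" for q
  proof -
    have "cmod (z - z') \<le> 4 * pi / real N"
      if "z \<in> sphere 0 1" "z' \<in> sphere 0 1" "f z = f z'" for z z'
    proof -
      define t t' where "t = Arg2pi (w z) / (2 * pi)" and "t' = Arg2pi (w z') / (2 * pi)"
      have "w z = cis (2 * pi * t)" "w z' = cis (2 * pi * t')"
        using cis_Arg imageI[of z "sphere 0 1" w] imageI[of z' "sphere 0 1" w] that(1,2)
        by (simp_all add: w_sphere t_def t'_def)
      have "necklace_loop N t = necklace_loop N t'"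
        using that(3) by (simp add: f_def p_def t_def t'_def)
      then obtain m :: int where m: "\<bar>t - t' - of_int m\<bar> \<le> 2 / real N"
        using necklace_loop_fibre[OF N(1)] Arg_range by (metis t_def t'_def)
      have "cmod (z - z') \<le> \<bar>2 * pi * t - 2 * pi * t' - 2 * pi * of_int m\<bar>"
        using cmod_cis_diff_le[of "2 * pi * t" "2 * pi * t'" m] w_dist[of z z']
          \<open>w z = cis (2 * pi * t)\<close> \<open>w z' = cis (2 * pi * t')\<close> by simp
      also have "\<dots> = 2 * pi * \<bar>t - t' - of_int m\<bar>"
        by (simp add: abs_mult flip: right_diff_distrib)
      also have "\<dots> \<le> 2 * pi * (2 / real N)" using m by (intro mult_left_mono) auto
      finally show ?thesis by simp
    qed
    then have "diameter {z \<in> sphere 0 1. f z = q} \<le> 4 * pi / real N"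
      by (intro diameter_le) auto
    then show ?thesis using N(2) by simp
  qed
  have "eps_map \<epsilon> (top_of_set (necklace N)) f"
    using f_cont f_image fibre by (auto simp: eps_map_def)
  moreover have "loop_class (top_of_set (necklace N)) (f x) (circle_loop x \<sigma> f)
      = loop_class (top_of_set (necklace N)) (torus N (0, 0)) (necklace_loop N)"
  proof -
    have eq: "homotopic_paths (necklace N) p (circle_loop x \<sigma> f)"
      using p_loop f_circle by (intro homotopic_paths_eq) (auto simp: circle_loop_def)
    have "loop_at (top_of_set (necklace N)) (torus N (0, 0)) p"
      using p_loop p_ends by (simp add: loop_at_iff pathstart_def pathfinish_def)
    then show ?thesis
      using loop_at_homotopic[OF _ eq] eq loop_class_eq_iff unfolding fx p_def by metis
  qed
  ultimately show ?thesis
    using is_graph_necklace[OF N(1)] f_image necklace_loop_not_in_free_basis[OF N(1)] fx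
    by (intro exI[of _ "top_of_set (necklace N)"] exI[of _ f]) auto
qed

end
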